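(* Let $\mathcal{A}$ be a dual Banach algebra and let $X$ be a normal dual Banach $\mathcal{A}$-bimodule. Then $\mathcal{A}\oplus_\infty X$ is weakly Connes-amenable if and only if the following conditions hold: 1. The only weak$^*$-continuous derivations $D:\mathcal{A}\to\mathcal{A}$ for which there is a weak$^*$-continuous linear operator $T:X\to X$ such that $T(a\cdot x)=D(a)\cdot x+a\cdot T(x)$ and $T(x\cdot a)=x\cdot D(a)+T(x)\cdot a$ for all $a\in\mathcal{A}$, $x\in X$, are the inner derivations. 2. $H^1_{w^*}(\mathcal{A},X)=\{0\}$. 3. The only weak$^*$-continuous $\mathcal{A}$-bimodule morphism $\Gamma:X\to\mathcal{A}$ for which $x\cdot\Gamma(y)+\Gamma(x)\cdot y=0$ for all $x,y\in X$ is zero. 4. For every weak$^*$-continuous $\mathcal{A}$-bimodule morphism $T:X\to X$ there exists $b\in\mathcal{A}$ such that $ab=ba$ for all $a\in\mathcal{A}$ and $T(x)=x\cdot b-b\cdot x$ for all $x\in X$.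
   Context: Boundedness convention: multiplications of Banach algebras and actions on Banach bimodules are bounded bilinear maps, i.e. the norm inequalities hold up to some constant (not necessarily $1$). A Banach algebra $\mathcal{A}$ is dual if there is a closed submodule $\mathcal{A}_*$ of $\mathcal{A}^*$ (the predual) such that $\mathcal{A}=(\mathcal{A}_* )^*$; the weak$^*$ topology on $\mathcal{A}$ is the one induced by $\mathcal{A}_*$. For a Banach $\mathcal{A}$-bimodule $Y$, the dual $Y^*$ is a Banach $\mathcal{A}$-bimodule via $\langle a\cdot y^*,y\rangle=\langle y^*,y\cdot a\rangle$ and $\langle y^*\cdot a,y\rangle=\langle y^*,a\cdot y\rangle$. A dual Banach $\mathcal{A}$-bimodule is a bimodule $X=(X_* )^*$ of this form, with predual $X_*$. It is normal if for every $x\in X$ the maps $a\mapsto a\cdot x$ and $a\mapsto x\cdot a$ are weak$^*$-continuous from $\mathcal{A}$ into $X$. An $\mathcal{A}$-bimodule morphism is a linear map commuting with the left and right actions of $\mathcal{A}$. Module extension: $\mathcal{A}\oplus_\infty X$ is the space of pairs $(a,x)$ with norm $\|(a,x)\|=\max\{\|a\|,\|x\|\}$ and product $(a_1,x_1)(a_2,x_2)=(a_1a_2,\,a_1\cdot x_2+x_1\cdot a_2)$; it is a dual Banach algebra with predual $\mathcal{A}_*\oplus_1X_*$ (norm $\|a'\|+\|x'\|$). A derivation from a dual Banach algebra $\mathcal{C}$ into a bimodule $Z$ is a linear map $D$ with $D(cd)=D(c)\cdot d+c\cdot D(d)$; it is inner if there is $z\in Z$ with $D(c)=c\cdot z-z\cdot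 c$ for all $c$. $H^1_{w^*}(\mathcal{C},Z)=\{0\}$ means every weak$^*$-continuous derivation $\mathcal{C}\to Z$ is inner. $\mathcal{C}$ is weakly Connes-amenable if every weak$^*$-continuous derivation $\mathcal{C}\to\mathcal{C}$ is inner. *)

theory Defs
  imports "HOL-Analysis.Analysis"
begin

section \<open>Complex Banach spaces\<close>

class complex_banach = banach +
  fixes scaleC :: "complex \<Rightarrow> 'a \<Rightarrow> 'a"  (infixr \<open>*\<^sub>C\<close> 75)
  assumes scaleC_add_right: "c *\<^sub>C (x + y) = c *\<^sub>C x + c *\<^sub>C y"
    and scaleC_add_left: "(c + d) *\<^sub>C x = c *\<^sub>C x + d *\<^sub>C x"
    and scaleC_scaleC: "c *\<^sub>C (d *\<^sub>C x) = (c * d) *\<^sub>C x"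
    and scaleC_of_real: "complex_of_real t *\<^sub>C x = t *\<^sub>R x"
    and norm_scaleC: "norm (c *\<^sub>C x) = cmod c * norm x"

lemma vector_space_scaleC: "vector_space (scaleC :: complex \<Rightarrow> 'a \<Rightarrow> 'a::complex_banach)"
  by unfold_locales
    (auto simp: scaleC_add_right scaleC_add_left scaleC_scaleC
      scaleC_of_real[of 1, simplified])

lemma scaleC_one [simp]: "1 *\<^sub>C x = (x::'a::complex_banach)"
  using scaleC_of_real[of 1 x] by simp

instantiation complex :: complex_banach
begin
definition scaleC_complex :: "complex \<Rightarrow> complex \<Rightarrow> complex" where
  "scaleC_complex c z = c * z"
instance
  by standard (auto simp: scaleC_complex_def algebra_simps norm_mult scaleR_conv_of_real)
end

instantiation blinfun :: (real_normed_vector, complex_banach) complex_banach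
begin
definition scaleC_blinfun ::
    "complex \<Rightarrow> ('a, 'b) blinfun \<Rightarrow> ('a, 'b) blinfun" where
  "scaleC_blinfun c f = Blinfun (\<lambda>x. c *\<^sub>C blinfun_apply f x)"

lemma bounded_linear_scaleC: "bounded_linear (\<lambda>x::'c::complex_banach. c *\<^sub>C x)"
proof (rule bounded_linear_intro[where K = "cmod c"])
  fix r :: real and x :: 'c
  show "c *\<^sub>C (r *\<^sub>R x) = r *\<^sub>R (c *\<^sub>C x)"
    by (simp flip: scaleC_of_real add: scaleC_scaleC mult.commute)
qed (simp_all add: scaleC_add_right norm_scaleC mult.commute)

lemma blinfun_apply_scaleC [simp]:
  "blinfun_apply (c *\<^sub>C (f :: ('a, 'b) blinfun)) x = c *\<^sub>C blinfun_apply f x"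
  unfolding scaleC_blinfun_def
  by (subst bounded_linear_Blinfun_apply)
    (auto intro: bounded_linear_compose[OF bounded_linear_scaleC blinfun.bounded_linear_right])

instance
proof
  fix c d :: complex and f g :: "('a, 'b) blinfun" and t :: real
  show "c *\<^sub>C (f + g) = c *\<^sub>C f + c *\<^sub>C g"
    by (rule blinfun_eqI) (simp add: blinfun.add_left scaleC_add_right)
  show "(c + d) *\<^sub>C f = c *\<^sub>C f + d *\<^sub>C f"
    by (rule blinfun_eqI) (simp add: blinfun.add_left scaleC_add_left)
  show assoc: "c *\<^sub>C (d *\<^sub>C f) = (c * d) *\<^sub>C f" for c d and f :: "('a, 'b) blinfun"
    by (rule blinfun_eqI) (simp add: scaleC_scaleC)
  show "complex_of_real t *\<^sub>C f = t *\<^sub>R f"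
    by (rule blinfun_eqI) (simp add: scaleC_of_real blinfun.scaleR_left)
  have le: "norm (c *\<^sub>C f) \<le> cmod c * norm f" for c and f :: "('a, 'b) blinfun"
  proof (rule norm_blinfun_bound)
    fix x show "norm (blinfun_apply (c *\<^sub>C f) x) \<le> cmod c * norm f * norm x"
      using norm_blinfun[of f x] by (simp add: norm_scaleC mult.assoc mult_left_mono)
  qed simp
  show "norm (c *\<^sub>C f) = cmod c * norm f"
  proof (cases "c = 0")
    case True
    then show ?thesis using le[of c f] by simp
  next
    case False
    have "f = inverse c *\<^sub>C (c *\<^sub>C f)"
      using False by (intro blinfun_eqI) (simp add: scaleC_scaleC)
    then have "norm f \<le> cmod (inverse c) * norm (c *\<^sub>C f)"
      using le[of "inverse c" "c *\<^sub>C f"] by simp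
    then have "cmod c * norm f \<le> norm (c *\<^sub>C f)"
      using False by (simp add: norm_divide norm_inverse field_simps)
    with le[of c f] show ?thesis by simp
  qed
qed
end

definition clinear :: "('a::complex_banach \<Rightarrow> 'b::complex_banach) \<Rightarrow> bool" where
  "clinear f \<longleftrightarrow> Vector_Spaces.linear scaleC scaleC f"

definition csubspace :: "'a::complex_banach set \<Rightarrow> bool" where
  "csubspace S \<longleftrightarrow> module.subspace scaleC S"

definition bounded_cbilinear ::
    "('a::complex_banach \<Rightarrow> 'b::complex_banach \<Rightarrow> 'c::complex_banach) \<Rightarrow> bool" where
  "bounded_cbilinear B \<longleftrightarrow>
     bounded_bilinear B \<and> (\<forall>x. clinear (B x)) \<and> (\<forall>y. clinear (\<lambda>x. B x y))"


section \<open>Duals, preduals and weak* topologies\<close>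

text \<open>Elements of the dual space are bounded real-linear maps that happen to be complex linear;
  their \<^typ>\<open>'a \<Rightarrow>\<^sub>L complex\<close> norm is the usual operator norm.\<close>

definition cdual :: "('a::complex_banach \<Rightarrow>\<^sub>L complex) set" where
  "cdual = {f. clinear (blinfun_apply f)}"

text \<open>The dual of a subspace \<open>S\<close>, whose elements are made unique as functions by
  being \<^const>\<open>undefined\<close> off \<open>S\<close>.\<close>

definition cdual_on :: "'v::complex_banach set \<Rightarrow> ('v \<Rightarrow> complex) set" where
  "cdual_on S = {\<Phi> \<in> extensional S.
     (\<forall>u\<in>S. \<forall>v\<in>S. \<Phi> (u + v) = \<Phi> u + \<Phi> v) \<and>
     (\<forall>c. \<forall>v\<in>S. \<Phi> (c *\<^sub>C v) = c * \<Phi> v) \<and>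
     (\<exists>K. \<forall>v\<in>S. cmod (\<Phi> v) \<le> K * norm v)}"

definition dual_norm_on :: "'v::complex_banach set \<Rightarrow> ('v \<Rightarrow> complex) \<Rightarrow> real" where
  "dual_norm_on S \<Phi> = (SUP v\<in>{v\<in>S. norm v \<le> 1}. cmod (\<Phi> v))"

definition eval_on :: "('a::complex_banach \<Rightarrow>\<^sub>L complex) set \<Rightarrow> 'a \<Rightarrow> ('a \<Rightarrow>\<^sub>L complex) \<Rightarrow> complex" where
  "eval_on P a = (\<lambda>f\<in>P. blinfun_apply f a)"

text \<open>\<open>P\<close> is a closed subspace of the dual of \<open>'a\<close> such that \<open>'a = P\<^sup>*\<close>, that is, the
  canonical map into \<open>P\<^sup>*\<close> is an isometric bijection.\<close>

definition predual :: "('a::complex_banach \<Rightarrow>\<^sub>L complex) set \<Rightarrow> bool" where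
  "predual P \<longleftrightarrow> P \<subseteq> cdual \<and> csubspace P \<and> closed P \<and>
     bij_betw (eval_on P) UNIV (cdual_on P) \<and>
     (\<forall>a. dual_norm_on P (eval_on P a) = norm a)"

definition weak_star :: "('a::complex_banach \<Rightarrow>\<^sub>L complex) set \<Rightarrow> 'a topology" where
  "weak_star P = topology_generated_by {blinfun_apply f -` U | f U. f \<in> P \<and> open U}"

abbreviation weak_star_continuous ::
    "('a::complex_banach \<Rightarrow>\<^sub>L complex) set \<Rightarrow> ('b::complex_banach \<Rightarrow>\<^sub>L complex) set \<Rightarrow> ('a \<Rightarrow> 'b) \<Rightarrow> bool" where
  "weak_star_continuous P Q \<equiv> continuous_map (weak_star P) (weak_star Q)"


section \<open>Banach algebras and bimodules\<close>

locale banach_algebra =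
  fixes mul :: "'a::complex_banach \<Rightarrow> 'a \<Rightarrow> 'a"
  assumes mul_bilinear: "bounded_cbilinear mul"
    and mul_assoc: "mul (mul a b) c = mul a (mul b c)"

locale banach_bimodule = banach_algebra mul
  for mul :: "'a::complex_banach \<Rightarrow> 'a \<Rightarrow> 'a" +
  fixes lact :: "'a \<Rightarrow> 'x::complex_banach \<Rightarrow> 'x"
    and ract :: "'x \<Rightarrow> 'a \<Rightarrow> 'x"
  assumes lact_bilinear: "bounded_cbilinear lact"
    and ract_bilinear: "bounded_cbilinear ract"
    and lact_lact: "lact a (lact b x) = lact (mul a b) x"
    and ract_ract: "ract (ract x a) b = ract x (mul a b)"
    and lact_ract: "ract (lact a x) b = lact a (ract x b)"

text \<open>The dual actions: \<open>\<langle>a \<cdot> f, x\<rangle> = \<langle>f, x \<cdot> a\<rangle>\<close> and \<open>\<langle>f \<cdot> a, x\<rangle> = \<langle>f, a \<cdot> x\<rangle>\<close>.\<close>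

definition dual_lact ::
    "('x::complex_banach \<Rightarrow> 'a \<Rightarrow> 'x) \<Rightarrow> 'a \<Rightarrow> ('x \<Rightarrow>\<^sub>L complex) \<Rightarrow> ('x \<Rightarrow>\<^sub>L complex)" where
  "dual_lact ract a f = Blinfun (\<lambda>x. blinfun_apply f (ract x a))"

definition dual_ract ::
    "('a \<Rightarrow> 'x::complex_banach \<Rightarrow> 'x) \<Rightarrow> ('x \<Rightarrow>\<^sub>L complex) \<Rightarrow> 'a \<Rightarrow> ('x \<Rightarrow>\<^sub>L complex)" where
  "dual_ract lact f a = Blinfun (\<lambda>x. blinfun_apply f (lact a x))"

text \<open>The predual is viewed inside the dual of the bimodule. Being a submodule there, it is a
  Banach bimodule under the dual actions, and the given actions are the ones dual to these:
  \<open>\<langle>a \<cdot> x, f\<rangle> = \<langle>x, f \<cdot> a\<rangle>\<close> and \<open>\<langle>x \<cdot> a, f\<rangle> = \<langle>x, a \<cdot> f\<rangle>\<close>.\<close>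

locale dual_banach_bimodule = banach_bimodule mul lact ract
  for mul :: "'a::complex_banach \<Rightarrow> 'a \<Rightarrow> 'a"
    and lact :: "'a \<Rightarrow> 'x::complex_banach \<Rightarrow> 'x"
    and ract :: "'x \<Rightarrow> 'a \<Rightarrow> 'x" +
  fixes Q :: "('x \<Rightarrow>\<^sub>L complex) set"
  assumes predual: "predual Q"
    and dual_lact_closed: "f \<in> Q \<Longrightarrow> dual_lact ract a f \<in> Q"
    and dual_ract_closed: "f \<in> Q \<Longrightarrow> dual_ract lact f a \<in> Q"

locale dual_banach_algebra = banach_algebra mul
  for mul :: "'a::complex_banach \<Rightarrow> 'a \<Rightarrow> 'a" +
  fixes P :: "('a \<Rightarrow>\<^sub>L complex) set"
  assumes predual: "predual P"
    and dual_lact_closed: "f \<in> P \<Longrightarrow> dual_lact mul a f \<in> P"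
    and dual_ract_closed: "f \<in> P \<Longrightarrow> dual_ract mul f a \<in> P"

locale normal_dual_banach_bimodule =
  A: dual_banach_algebra mul P + dual_banach_bimodule mul lact ract Q
  for mul :: "'a::complex_banach \<Rightarrow> 'a \<Rightarrow> 'a" and P
    and lact :: "'a \<Rightarrow> 'x::complex_banach \<Rightarrow> 'x"
    and ract :: "'x \<Rightarrow> 'a \<Rightarrow> 'x" and Q +
  assumes lact_weak_star_continuous: "weak_star_continuous P Q (\<lambda>a. lact a x)"
    and ract_weak_star_continuous: "weak_star_continuous P Q (\<lambda>a. ract x a)"

definition bimodule_morphism ::
    "('a \<Rightarrow> 'x::complex_banach \<Rightarrow> 'x) \<Rightarrow> ('x \<Rightarrow> 'a \<Rightarrow> 'x) \<Rightarrow>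
     ('a \<Rightarrow> 'y::complex_banach \<Rightarrow> 'y) \<Rightarrow> ('y \<Rightarrow> 'a \<Rightarrow> 'y) \<Rightarrow> ('x \<Rightarrow> 'y) \<Rightarrow> bool" where
  "bimodule_morphism lX rX lY rY T \<longleftrightarrow> clinear T \<and>
     (\<forall>a x. T (lX a x) = lY a (T x)) \<and> (\<forall>x a. T (rX x a) = rY (T x) a)"


section \<open>Derivations and weak Connes-amenability\<close>

definition derivation ::
    "('a::complex_banach \<Rightarrow> 'a \<Rightarrow> 'a) \<Rightarrow> ('a \<Rightarrow> 'x::complex_banach \<Rightarrow> 'x) \<Rightarrow> ('x \<Rightarrow> 'a \<Rightarrow> 'x) \<Rightarrow>
     ('a \<Rightarrow> 'x) \<Rightarrow> bool" where
  "derivation mul lact ract D \<longleftrightarrow> clinear D \<and>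
     (\<forall>c d. D (mul c d) = ract (D c) d + lact c (D d))"

definition inner_derivation ::
    "('a \<Rightarrow> 'x::complex_banach \<Rightarrow> 'x) \<Rightarrow> ('x \<Rightarrow> 'a \<Rightarrow> 'x) \<Rightarrow> ('a \<Rightarrow> 'x) \<Rightarrow> bool" where
  "inner_derivation lact ract D \<longleftrightarrow> (\<exists>z. \<forall>c. D c = lact c z - ract z c)"

text \<open>\<open>H\<^sup>1\<^bsub>w*\<^esub> = {0}\<close>\<close>

definition H1_weak_star_trivial ::
    "('a::complex_banach \<Rightarrow> 'a \<Rightarrow> 'a) \<Rightarrow> ('a \<Rightarrow>\<^sub>L complex) set \<Rightarrow>
     ('a \<Rightarrow> 'x::complex_banach \<Rightarrow> 'x) \<Rightarrow> ('x \<Rightarrow> 'a \<Rightarrow> 'x) \<Rightarrow> ('x \<Rightarrow>\<^sub>L complex) set \<Rightarrow> bool" where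
  "H1_weak_star_trivial mul P lact ract Q \<longleftrightarrow>
     (\<forall>D. derivation mul lact ract D \<and> weak_star_continuous P Q D \<longrightarrow>
        inner_derivation lact ract D)"

definition weakly_connes_amenable ::
    "('a::complex_banach \<Rightarrow> 'a \<Rightarrow> 'a) \<Rightarrow> ('a \<Rightarrow>\<^sub>L complex) set \<Rightarrow> bool" where
  "weakly_connes_amenable mul P \<longleftrightarrow> H1_weak_star_trivial mul P mul mul P"


section \<open>Module extensions\<close>

text \<open>A separate type is needed since the norm of the library's product type is Euclidean.\<close>

datatype ('a, 'x) mod_ext = Mod_Ext (alg_part: 'a) (mod_part: 'x)

instantiation mod_ext :: (real_normed_vector, real_normed_vector) real_normed_vector
begin

definition "0 = Mod_Ext 0 0"
definition "u + v = Mod_Ext (alg_part u + alg_part v) (mod_part u + mod_part v)"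
definition "u - v = Mod_Ext (alg_part u - alg_part v) (mod_part u - mod_part v)"
definition "- u = Mod_Ext (- alg_part u) (- mod_part u)"
definition "t *\<^sub>R u = Mod_Ext (t *\<^sub>R alg_part u) (t *\<^sub>R mod_part u)"
definition norm_mod_ext :: "('a, 'b) mod_ext \<Rightarrow> real" where
  "norm_mod_ext u = max (norm (alg_part u)) (norm (mod_part u))"
definition dist_mod_ext :: "('a, 'b) mod_ext \<Rightarrow> ('a, 'b) mod_ext \<Rightarrow> real" where
  "dist_mod_ext u v = norm (u - v)"
definition sgn_mod_ext :: "('a, 'b) mod_ext \<Rightarrow> ('a, 'b) mod_ext" where
  "sgn_mod_ext u = inverse (norm u) *\<^sub>R u"
definition uniformity_mod_ext :: "(('a, 'b) mod_ext \<times> ('a, 'b) mod_ext) filter" where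
  "uniformity_mod_ext = (INF e\<in>{0<..}. principal {(u, v). dist u v < e})"
definition open_mod_ext :: "('a, 'b) mod_ext set \<Rightarrow> bool" where
  "open_mod_ext U \<longleftrightarrow> (\<forall>u\<in>U. \<forall>\<^sub>F (u', v) in uniformity. u' = u \<longrightarrow> v \<in> U)"

lemma mod_ext_sel [simp]:
  fixes u v :: "('a, 'b) mod_ext"
  shows "alg_part (0 :: ('a, 'b) mod_ext) = 0" "mod_part (0 :: ('a, 'b) mod_ext) = 0"
    "alg_part (u + v) = alg_part u + alg_part v" "mod_part (u + v) = mod_part u + mod_part v"
    "alg_part (u - v) = alg_part u - alg_part v" "mod_part (u - v) = mod_part u - mod_part v"
    "alg_part (- u) = - alg_part u" "mod_part (- u) = - mod_part u"
    "alg_part (t *\<^sub>R u) = t *\<^sub>R alg_part u" "mod_part (t *\<^sub>R u) = t *\<^sub>R mod_part u"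
  by (simp_all add: zero_mod_ext_def plus_mod_ext_def minus_mod_ext_def uminus_mod_ext_def
    scaleR_mod_ext_def)

instance
proof intro_classes
  fix u v :: "('a, 'b) mod_ext" and r :: real
  show "norm (u + v) \<le> norm u + norm v"
    using norm_triangle_ineq[of "alg_part u" "alg_part v"]
      norm_triangle_ineq[of "mod_part u" "mod_part v"]
    unfolding norm_mod_ext_def mod_ext_sel by linarith
  show "norm (r *\<^sub>R u) = \<bar>r\<bar> * norm u"
    by (simp add: norm_mod_ext_def max_mult_distrib_left)
  show "(norm u = 0) = (u = 0)"
    using norm_ge_zero[of "alg_part u"] norm_ge_zero[of "mod_part u"]
    by (auto simp: norm_mod_ext_def max_def intro!: mod_ext.expand
      simp del: norm_ge_zero split: if_splits)
qed (auto intro!: mod_ext.expand simp: algebra_simps dist_mod_ext_def sgn_mod_ext_def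
      uniformity_mod_ext_def open_mod_ext_def)
end

instance mod_ext :: (banach, banach) banach
proof
  fix X :: "nat \<Rightarrow> ('a, 'b) mod_ext"
  assume "Cauchy X"
  then have "Cauchy (\<lambda>n. alg_part (X n))" "Cauchy (\<lambda>n. mod_part (X n))"
    by (force simp: Cauchy_def dist_mod_ext_def norm_mod_ext_def dist_norm)+
  then obtain a x where "(\<lambda>n. alg_part (X n)) \<longlonglongrightarrow> a" "(\<lambda>n. mod_part (X n)) \<longlonglongrightarrow> x"
    by (auto dest!: Cauchy_convergent simp: convergent_def)
  then have "(\<lambda>n. max (norm (alg_part (X n) - a)) (norm (mod_part (X n) - x)))
      \<longlonglongrightarrow> max 0 0"
    by (intro tendsto_max tendsto_norm_zero) (simp_all add: LIM_zero)
  then have "X \<longlonglongrightarrow> Mod_Ext a x"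
    by (subst tendsto_dist_iff) (simp add: dist_mod_ext_def norm_mod_ext_def)
  then show "convergent X"
    by (auto simp: convergent_def)
qed

instantiation mod_ext :: (complex_banach, complex_banach) complex_banach
begin

definition "c *\<^sub>C u = Mod_Ext (c *\<^sub>C alg_part u) (c *\<^sub>C mod_part u)"

lemma mod_ext_sel_scaleC [simp]:
  fixes u :: "('a, 'b) mod_ext"
  shows "alg_part (c *\<^sub>C u) = c *\<^sub>C alg_part u" "mod_part (c *\<^sub>C u) = c *\<^sub>C mod_part u"
  by (simp_all add: scaleC_mod_ext_def)

instance
  by standard (auto intro!: mod_ext.expand simp: norm_mod_ext_def max_mult_distrib_left norm_scaleC
      scaleC_add_left scaleC_add_right scaleC_scaleC scaleC_of_real)
end

definition mod_ext_mul ::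
    "('a \<Rightarrow> 'a \<Rightarrow> 'a) \<Rightarrow> ('a \<Rightarrow> 'x \<Rightarrow> 'x) \<Rightarrow> ('x \<Rightarrow> 'a \<Rightarrow> 'x) \<Rightarrow>
     ('a::complex_banach, 'x::complex_banach) mod_ext \<Rightarrow> ('a, 'x) mod_ext \<Rightarrow> ('a, 'x) mod_ext" where
  "mod_ext_mul mul lact ract u v =
     Mod_Ext (mul (alg_part u) (alg_part v))
       (lact (alg_part u) (mod_part v) + ract (mod_part u) (alg_part v))"

definition mod_ext_functional ::
    "('a::complex_banach \<Rightarrow>\<^sub>L complex) \<Rightarrow> ('x::complex_banach \<Rightarrow>\<^sub>L complex) \<Rightarrow>
     ('a, 'x) mod_ext \<Rightarrow>\<^sub>L complex" where
  "mod_ext_functional f g =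
     Blinfun (\<lambda>u. blinfun_apply f (alg_part u) + blinfun_apply g (mod_part u))"

definition mod_ext_predual ::
    "('a::complex_banach \<Rightarrow>\<^sub>L complex) set \<Rightarrow> ('x::complex_banach \<Rightarrow>\<^sub>L complex) set \<Rightarrow>
     (('a, 'x) mod_ext \<Rightarrow>\<^sub>L complex) set" where
  "mod_ext_predual P Q = {mod_ext_functional f g | f g. f \<in> P \<and> g \<in> Q}"

lemma clinear_iff:
  "clinear f \<longleftrightarrow> (\<forall>x y. f (x + y) = f x + f y) \<and> (\<forall>c x. f (c *\<^sub>C x) = c *\<^sub>C f x)"
  by (auto simp: clinear_def Vector_Spaces.linear_iff vector_space_scaleC)

lemma csubspace_iff:
  "csubspace S \<longleftrightarrow> 0 \<in> S \<and> (\<forall>x\<in>S. \<forall>y\<in>S. x + y \<in> S) \<and> (\<forall>c. \<forall>x\<in>S. c *\<^sub>C x \<in> S)"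
proof -
  interpret vector_space scaleC by (rule vector_space_scaleC)
  show ?thesis by (auto simp: csubspace_def subspace_def)
qed

lemma bounded_linear_Mod_Ext:
  "bounded_linear (\<lambda>a. Mod_Ext a (0::'x::real_normed_vector))"
  "bounded_linear (\<lambda>x. Mod_Ext (0::'a::real_normed_vector) x)"
  by (rule bounded_linear_intro[where K = 1];
      simp add: plus_mod_ext_def scaleR_mod_ext_def norm_mod_ext_def)+

lemma bounded_linear_mod_ext_sel:
  "bounded_linear (alg_part :: ('a::real_normed_vector, 'x::real_normed_vector) mod_ext \<Rightarrow> 'a)"
  "bounded_linear (mod_part :: ('a::real_normed_vector, 'x::real_normed_vector) mod_ext \<Rightarrow> 'x)"
  by (rule bounded_linear_intro[where K = 1]; simp add: norm_mod_ext_def)+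

lemma mod_ext_functional_apply [simp]:
  "blinfun_apply (mod_ext_functional f g) u =
     blinfun_apply f (alg_part u) + blinfun_apply g (mod_part u)"
  unfolding mod_ext_functional_def
  by (subst bounded_linear_Blinfun_apply)
    (auto intro!: bounded_linear_add
      bounded_linear_compose[OF blinfun.bounded_linear_right bounded_linear_mod_ext_sel(1)]
      bounded_linear_compose[OF blinfun.bounded_linear_right bounded_linear_mod_ext_sel(2)])

text \<open>The operator norm dual to the max norm is the \<open>\<ell>\<^sub>1\<close>-norm, so \<open>mod_ext_predual\<close> is the
  \<open>\<ell>\<^sub>1\<close>-sum of the preduals.\<close>

lemma norm_mod_ext_functional:
  assumes "f \<in> cdual" "g \<in> cdual"
  shows "norm (mod_ext_functional f g) = norm f + norm g"
proof (rule antisym)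
  show "norm (mod_ext_functional f g) \<le> norm f + norm g"
  proof (rule norm_blinfun_bound)
    fix u
    have "cmod (blinfun_apply (mod_ext_functional f g) u) \<le>
        norm f * norm (alg_part u) + norm g * norm (mod_part u)"
      using norm_blinfun[of f "alg_part u"] norm_blinfun[of g "mod_part u"]
      by (auto intro: norm_triangle_le)
    also have "\<dots> \<le> norm f * norm u + norm g * norm u"
      by (intro add_mono mult_left_mono) (auto simp: norm_mod_ext_def)
    finally show "cmod (blinfun_apply (mod_ext_functional f g) u) \<le> (norm f + norm g) * norm u"
      by (simp add: algebra_simps)
  qed simp
  have *: "cmod (blinfun_apply f a) + cmod (blinfun_apply g x) \<le> norm (mod_ext_functional f g)"
    if "norm a \<le> 1" "norm x \<le> 1" for a x
  proof -
    define r where "r z = (if z = 0 then 1 else cnj z / cmod z)" for z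
    have r: "cmod (r z) = 1" "r z * z = cmod z" for z
      by (auto simp: r_def norm_divide complex_norm_square[symmetric] mult.commute[of "cnj z"]
        power2_eq_square)
    let ?u = "Mod_Ext (r (blinfun_apply f a) *\<^sub>C a) (r (blinfun_apply g x) *\<^sub>C x)"
    have "blinfun_apply (mod_ext_functional f g) ?u
        = of_real (cmod (blinfun_apply f a) + cmod (blinfun_apply g x))"
      using assms by (simp add: cdual_def clinear_iff scaleC_complex_def r)
    moreover have "norm ?u \<le> 1"
      using that by (simp add: norm_mod_ext_def norm_scaleC r)
    ultimately show ?thesis
      using norm_blinfun[of "mod_ext_functional f g" ?u]
        mult_left_mono[of "norm ?u" 1 "norm (mod_ext_functional f g)"]
      by (simp only: norm_of_real) simp
  qed
  have sup: "norm h \<le> c"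
    if "\<And>a. norm a \<le> 1 \<Longrightarrow> cmod (blinfun_apply h a) \<le> c" for h :: "'c::complex_banach \<Rightarrow>\<^sub>L complex" and c
  proof (rule norm_blinfun_bound)
    show "0 \<le> c" using that[of 0] by simp
    fix a
    show "cmod (blinfun_apply h a) \<le> c * norm a"
    proof (cases "a = 0")
      case False
      then show ?thesis
        using that[of "inverse (norm a) *\<^sub>R a"]
        by (simp add: blinfun.scaleR_right field_simps)
    qed simp
  qed
  have "norm f \<le> norm (mod_ext_functional f g) - cmod (blinfun_apply g x)" if "norm x \<le> 1" for x
    using *[OF _ that] by (intro sup) (simp add: algebra_simps)
  then have "norm g \<le> norm (mod_ext_functional f g) - norm f"
    by (intro sup) (simp add: algebra_simps)
  then show "norm f + norm g \<le> norm (mod_ext_functional f g)" by simp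
qed

lemma mod_ext_predual_iff:
  "h \<in> mod_ext_predual P Q \<longleftrightarrow>
     h o\<^sub>L Blinfun (\<lambda>a. Mod_Ext a 0) \<in> P \<and> h o\<^sub>L Blinfun (Mod_Ext 0) \<in> Q"
proof -
  have *: "blinfun_apply (Blinfun (\<lambda>a. Mod_Ext a (0::'b))) a = Mod_Ext a 0"
    "blinfun_apply (Blinfun (\<lambda>x. Mod_Ext (0::'a) x)) x = Mod_Ext 0 x" for a x
    by (simp_all add: bounded_linear_Blinfun_apply bounded_linear_Mod_Ext)
  have "mod_ext_functional f g o\<^sub>L Blinfun (\<lambda>a. Mod_Ext a 0) = f"
    "mod_ext_functional f g o\<^sub>L Blinfun (Mod_Ext 0) = g" for f :: "'a \<Rightarrow>\<^sub>L complex" and g :: "'b \<Rightarrow>\<^sub>L complex"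
    by (auto intro!: blinfun_eqI simp: * )
  moreover have "h = mod_ext_functional (h o\<^sub>L Blinfun (\<lambda>a. Mod_Ext a 0)) (h o\<^sub>L Blinfun (Mod_Ext 0))"
    by (rule blinfun_eqI) (simp add: * plus_mod_ext_def flip: blinfun.add_right)
  ultimately show ?thesis
    unfolding mod_ext_predual_def by (auto; metis)
qed

lemma predual_mod_ext:
  assumes P: "predual (P :: ('a::complex_banach \<Rightarrow>\<^sub>L complex) set)"
    and Q: "predual (Q :: ('x::complex_banach \<Rightarrow>\<^sub>L complex) set)"
  shows "predual (mod_ext_predual P Q)"
proof -
  let ?R = "mod_ext_predual P Q" and ?F = mod_ext_functional
  have sub: "P \<subseteq> cdual" "Q \<subseteq> cdual" and cl: "closed P" "closed Q"
    using P Q by (auto simp: predual_def)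
  have cs: "0 \<in> P" "\<And>f g. f \<in> P \<Longrightarrow> g \<in> P \<Longrightarrow> f + g \<in> P" "\<And>c f. f \<in> P \<Longrightarrow> c *\<^sub>C f \<in> P"
    "0 \<in> Q" "\<And>f g. f \<in> Q \<Longrightarrow> g \<in> Q \<Longrightarrow> f + g \<in> Q" "\<And>c f. f \<in> Q \<Longrightarrow> c *\<^sub>C f \<in> Q"
    using P Q by (auto simp: predual_def csubspace_iff)
  have F_add: "?F f g + ?F f' g' = ?F (f + f') (g + g')"
    and F_scale: "c *\<^sub>C ?F f g = ?F (c *\<^sub>C f) (c *\<^sub>C g)"
    and F_zero: "?F 0 0 = 0"
    for f f' :: "'a \<Rightarrow>\<^sub>L complex" and g g' :: "'x \<Rightarrow>\<^sub>L complex" and c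
    by (auto intro!: blinfun_eqI simp: blinfun.add_left scaleC_add_right)
  have R: "?F f g \<in> ?R" if "f \<in> P" "g \<in> Q" for f g
    using that by (auto simp: mod_ext_predual_def)
  have nF: "norm (?F f g) = norm f + norm g" if "f \<in> P" "g \<in> Q" for f g
    using that sub by (auto intro: norm_mod_ext_functional)
  have 1: "?R \<subseteq> cdual"
    using sub by (auto simp: mod_ext_predual_def cdual_def clinear_iff scaleC_add_right subset_iff)
  have 2: "csubspace ?R"
    unfolding csubspace_iff mod_ext_predual_def
    by (auto simp: F_add F_scale) (metis F_zero cs | metis cs)+
  have 3: "closed ?R"
  proof -
    have "?R = (\<lambda>h. h o\<^sub>L Blinfun (\<lambda>a. Mod_Ext a 0)) -` P \<inter> (\<lambda>h. h o\<^sub>L Blinfun (Mod_Ext 0)) -` Q"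
      by (auto simp: mod_ext_predual_iff)
    then show ?thesis
      using cl by (auto intro!: closed_Int closed_vimage continuous_intros)
  qed
  have ev: "(SUP f\<in>{f\<in>P. norm f \<le> 1}. cmod (blinfun_apply f a)) = norm a"
    if "predual P" for a and P :: "('c::complex_banach \<Rightarrow>\<^sub>L complex) set"
    using that by (auto simp: predual_def dual_norm_on_def eval_on_def cong: SUP_cong_simp)
  have bdd: "bdd_above ((\<lambda>f. cmod (blinfun_apply f a)) ` {f\<in>P. norm f \<le> 1})"
    for a and P :: "('c::complex_banach \<Rightarrow>\<^sub>L complex) set"
  proof (rule bdd_aboveI2)
    fix f assume "f \<in> {f\<in>P. norm f \<le> 1}"
    then show "cmod (blinfun_apply f a) \<le> norm a"
      using norm_blinfun[of f a] mult_right_mono[of "norm f" 1 "norm a"] by simp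
  qed
  have 4: "dual_norm_on ?R (eval_on ?R u) = norm u" for u
  proof -
    have "dual_norm_on ?R (eval_on ?R u) = (SUP h\<in>{h\<in>?R. norm h \<le> 1}. cmod (blinfun_apply h u))"
      by (auto simp: dual_norm_on_def eval_on_def cong: SUP_cong_simp)
    also have "\<dots> = norm u"
    proof (rule antisym)
      show "(SUP h\<in>{h\<in>?R. norm h \<le> 1}. cmod (blinfun_apply h u)) \<le> norm u"
      proof (rule cSUP_least)
        show "{h \<in> ?R. norm h \<le> 1} \<noteq> {}" using 2 by (auto simp: csubspace_iff intro!: exI[of _ 0])
        fix h assume "h \<in> {h \<in> ?R. norm h \<le> 1}"
        then show "cmod (blinfun_apply h u) \<le> norm u"
          using norm_blinfun[of h u] mult_right_mono[of "norm h" 1 "norm u"] by simp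
      qed
      have "norm (alg_part u) \<le> (SUP h\<in>{h\<in>?R. norm h \<le> 1}. cmod (blinfun_apply h u))"
        unfolding ev[OF P, symmetric]
      proof (rule cSUP_mono)
        show "{f \<in> P. norm f \<le> 1} \<noteq> {}" using cs by (auto intro!: exI[of _ 0])
        fix f assume "f \<in> {f \<in> P. norm f \<le> 1}"
        then show "\<exists>h\<in>{h \<in> ?R. norm h \<le> 1}. cmod (blinfun_apply f (alg_part u)) \<le> cmod (blinfun_apply h u)"
          by (intro bexI[of _ "?F f 0"]) (auto simp: nF cs intro!: R)
      qed (rule bdd)
      moreover have "norm (mod_part u) \<le> (SUP h\<in>{h\<in>?R. norm h \<le> 1}. cmod (blinfun_apply h u))"
        unfolding ev[OF Q, symmetric]
      proof (rule cSUP_mono)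
        show "{f \<in> Q. norm f \<le> 1} \<noteq> {}" using cs by (auto intro!: exI[of _ 0])
        fix f assume "f \<in> {f \<in> Q. norm f \<le> 1}"
        then show "\<exists>h\<in>{h \<in> ?R. norm h \<le> 1}. cmod (blinfun_apply f (mod_part u)) \<le> cmod (blinfun_apply h u)"
          by (intro bexI[of _ "?F 0 f"]) (auto simp: nF cs intro!: R)
      qed (rule bdd)
      ultimately show "norm u \<le> (SUP h\<in>{h\<in>?R. norm h \<le> 1}. cmod (blinfun_apply h u))"
        by (simp add: norm_mod_ext_def)
    qed
    finally show ?thesis .
  qed
  have "inj (eval_on ?R)"
  proof (rule injI)
    fix u v assume eq: "eval_on ?R u = eval_on ?R v"
    have "blinfun_apply h u = blinfun_apply h v" if "h \<in> ?R" for h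
      using fun_cong[OF eq, of h] that by (simp add: eval_on_def)
    then have "eval_on ?R (u - v) = eval_on ?R 0"
      by (auto simp: eval_on_def fun_eq_iff blinfun.diff_right)
    then show "u = v" using 4[of "u - v"] 4[of 0] by simp
  qed
  moreover have "eval_on ?R u \<in> cdual_on ?R" for u
    using 2 norm_blinfun[of _ u]
    by (auto simp: cdual_on_def eval_on_def csubspace_iff blinfun.add_left scaleC_complex_def
      mult.commute intro!: exI[of _ "norm u"])
  moreover have "\<exists>u. \<Phi> = eval_on ?R u" if \<Phi>: "\<Phi> \<in> cdual_on ?R" for \<Phi>
  proof -
    have add: "\<And>h k. h \<in> ?R \<Longrightarrow> k \<in> ?R \<Longrightarrow> \<Phi> (h + k) = \<Phi> h + \<Phi> k"
      and scale: "\<And>c h. h \<in> ?R \<Longrightarrow> \<Phi> (c *\<^sub>C h) = c * \<Phi> h"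
      and ext: "\<And>h. h \<notin> ?R \<Longrightarrow> \<Phi> h = undefined"
      using \<Phi> by (auto simp: cdual_on_def extensional_def)
    obtain K where K: "\<And>h. h \<in> ?R \<Longrightarrow> cmod (\<Phi> h) \<le> K * norm h"
      using \<Phi> unfolding cdual_on_def by blast
    have "(\<lambda>f\<in>P. \<Phi> (?F f 0)) \<in> cdual_on P"
    proof -
      have "\<Phi> (?F (f + f') 0) = \<Phi> (?F f 0) + \<Phi> (?F f' 0)" if "f \<in> P" "f' \<in> P" for f f'
        using add[OF R R, of f 0 f' 0] that cs by (simp add: F_add)
      moreover have "\<Phi> (?F (c *\<^sub>C f) 0) = c * \<Phi> (?F f 0)" if "f \<in> P" for c f
      proof -
        have "c *\<^sub>C ?F f 0 = ?F (c *\<^sub>C f) 0"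
          by (auto intro!: blinfun_eqI simp: scaleC_complex_def)
        then show ?thesis using scale[OF R, of f 0 c] that cs by metis
      qed
      moreover have "cmod (\<Phi> (?F f 0)) \<le> K * norm f" if "f \<in> P" for f
        using K[OF R, of f 0] nF[of f 0] that cs by simp
      ultimately show ?thesis using cs by (auto simp: cdual_on_def intro!: exI[of _ K])
    qed
    then obtain a where a: "(\<lambda>f\<in>P. \<Phi> (?F f 0)) = eval_on P a"
      using P unfolding predual_def bij_betw_def by (metis imageE)
    have "(\<lambda>g\<in>Q. \<Phi> (?F 0 g)) \<in> cdual_on Q"
    proof -
      have "\<Phi> (?F 0 (f + f')) = \<Phi> (?F 0 f) + \<Phi> (?F 0 f')" if "f \<in> Q" "f' \<in> Q" for f f'
        using add[OF R R, of 0 f 0 f'] that cs by (simp add: F_add)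
      moreover have "\<Phi> (?F 0 (c *\<^sub>C f)) = c * \<Phi> (?F 0 f)" if "f \<in> Q" for c f
      proof -
        have "c *\<^sub>C ?F 0 f = ?F 0 (c *\<^sub>C f)"
          by (auto intro!: blinfun_eqI simp: scaleC_complex_def)
        then show ?thesis using scale[OF R, of 0 f c] that cs by metis
      qed
      moreover have "cmod (\<Phi> (?F 0 f)) \<le> K * norm f" if "f \<in> Q" for f
        using K[OF R, of 0 f] nF[of 0 f] that cs by simp
      ultimately show ?thesis using cs by (auto simp: cdual_on_def intro!: exI[of _ K])
    qed
    then obtain x where x: "(\<lambda>g\<in>Q. \<Phi> (?F 0 g)) = eval_on Q x"
      using Q unfolding predual_def bij_betw_def by (metis imageE)
    have "\<Phi> (?F f g) = blinfun_apply (?F f g) (Mod_Ext a x)" if "f \<in> P" "g \<in> Q" for f g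
    proof -
      have "\<Phi> (?F f g) = \<Phi> (?F f 0) + \<Phi> (?F 0 g)"
        using add[OF R R, of f 0 0 g] that cs by (simp add: F_add)
      then show ?thesis
        using fun_cong[OF a, of f] fun_cong[OF x, of g] that by (simp add: eval_on_def)
    qed
    then have "\<Phi> = eval_on ?R (Mod_Ext a x)"
      using ext by (auto simp: eval_on_def fun_eq_iff mod_ext_predual_def)
    then show ?thesis by blast
  qed
  ultimately have "bij_betw (eval_on ?R) UNIV (cdual_on ?R)"
    unfolding bij_betw_def by blast
  with 1 2 3 4 show ?thesis by (simp add: predual_def)
qed

lemma banach_algebra_mod_ext:
  assumes "banach_bimodule mul lact ract"
  shows "banach_algebra (mod_ext_mul mul lact ract)"
proof -
  interpret banach_bimodule mul lact ract by fact
  interpret m: bounded_bilinear mul using mul_bilinear by (simp add: bounded_cbilinear_def)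
  interpret l: bounded_bilinear lact using lact_bilinear by (simp add: bounded_cbilinear_def)
  interpret r: bounded_bilinear ract using ract_bilinear by (simp add: bounded_cbilinear_def)
  let ?m = "mod_ext_mul mul lact ract"
  obtain K where K: "\<And>a b. norm (mul a b) \<le> norm a * norm b * K" "K \<ge> 0"
    using m.nonneg_bounded by blast
  obtain L where L: "\<And>a b. norm (lact a b) \<le> norm a * norm b * L" "L \<ge> 0"
    using l.nonneg_bounded by blast
  obtain M where M: "\<And>a b. norm (ract a b) \<le> norm a * norm b * M" "M \<ge> 0"
    using r.nonneg_bounded by blast
  have "bounded_bilinear ?m"
  proof
    have "norm (?m u v) \<le> norm u * norm v * (K + L + M)" for u v
    proof -
      have le: "norm (alg_part w) \<le> norm w" "norm (mod_part w) \<le> norm w"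
        for w :: "('a, 'b) mod_ext"
        by (simp_all add: norm_mod_ext_def)
      have "norm (mul (alg_part u) (alg_part v)) \<le> norm u * norm v * K"
        by (rule order_trans[OF K(1)]) (intro mult_right_mono mult_mono le K(2) norm_ge_zero)
      moreover have "norm (lact (alg_part u) (mod_part v)) \<le> norm u * norm v * L"
        by (rule order_trans[OF L(1)]) (intro mult_right_mono mult_mono le L(2) norm_ge_zero)
      moreover have "norm (ract (mod_part u) (alg_part v)) \<le> norm u * norm v * M"
        by (rule order_trans[OF M(1)]) (intro mult_right_mono mult_mono le M(2) norm_ge_zero)
      moreover have "0 \<le> norm u * norm v * K" "0 \<le> norm u * norm v * L" "0 \<le> norm u * norm v * M"
        using K(2) L(2) M(2) by simp_all
      ultimately show ?thesis
        using norm_triangle_ineq[of "lact (alg_part u) (mod_part v)" "ract (mod_part u) (alg_part v)"]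
        unfolding norm_mod_ext_def[of "?m u v"]
        by (simp add: mod_ext_mul_def distrib_left)
    qed
    then show "\<exists>K. \<forall>u v. norm (?m u v) \<le> norm u * norm v * K" by blast
  qed (auto intro!: mod_ext.expand simp: mod_ext_mul_def m.add_left m.add_right l.add_left
      l.add_right r.add_left r.add_right m.scaleR_left m.scaleR_right l.scaleR_left
      l.scaleR_right r.scaleR_left r.scaleR_right scaleR_add_right)
  moreover have "clinear (?m u)" "clinear (\<lambda>u. ?m u v)" for u v
    using mul_bilinear lact_bilinear ract_bilinear
    by (auto intro!: mod_ext.expand simp: mod_ext_mul_def bounded_cbilinear_def clinear_iff
      scaleC_add_right)
  moreover have "?m (?m u v) w = ?m u (?m v w)" for u v w
    by (simp add: mod_ext_mul_def mul_assoc lact_lact ract_ract lact_ract l.add_right r.add_left)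
  ultimately show ?thesis
    by unfold_locales (simp_all add: bounded_cbilinear_def)
qed

lemma weak_star_open_kernels:
  assumes "openin (weak_star P) U" "u \<in> U"
  shows "\<exists>F. finite F \<and> F \<subseteq> P \<and> (\<forall>v. (\<forall>f\<in>F. blinfun_apply f v = blinfun_apply f u) \<longrightarrow> v \<in> U)"
proof -
  define S where "S = {blinfun_apply f -` U | f U. f \<in> P \<and> open U}"
  have "generate_topology_on S U"
    using assms(1) unfolding weak_star_def S_def openin_topology_generated_by_iff .
  then show ?thesis using \<open>u \<in> U\<close>
  proof (induction rule: generate_topology_on.induct)
    case (Int a b)
    then have u: "u \<in> a" "u \<in> b" by simp_all
    from Int.IH(1)[OF u(1)] obtain F where F: "finite F" "F \<subseteq> P"
      "\<forall>v. (\<forall>f\<in>F. blinfun_apply f v = blinfun_apply f u) \<longrightarrow> v \<in> a" by (elim exE conjE)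
    from Int.IH(2)[OF u(2)] obtain G where G: "finite G" "G \<subseteq> P"
      "\<forall>v. (\<forall>f\<in>G. blinfun_apply f v = blinfun_apply f u) \<longrightarrow> v \<in> b" by (elim exE conjE)
    from F G have "finite (F \<union> G)" "F \<union> G \<subseteq> P"
      "\<forall>v. (\<forall>f\<in>F \<union> G. blinfun_apply f v = blinfun_apply f u) \<longrightarrow> v \<in> a \<inter> b"
      by simp_all
    then show ?case by (intro exI conjI)
  next
    case (UN K)
    then obtain k where "k \<in> K" "u \<in> k" by blast
    from UN.IH[OF this] obtain F where "finite F" "F \<subseteq> P"
      "\<forall>v. (\<forall>f\<in>F. blinfun_apply f v = blinfun_apply f u) \<longrightarrow> v \<in> k" by (elim exE conjE)
    with \<open>k \<in> K\<close> show ?case by (intro exI[of _ F]) (simp, metis)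
  next
    case (Basis s)
    then obtain f U where f: "s = blinfun_apply f -` U" "f \<in> P" by (auto simp: S_def)
    then have "\<forall>v. (\<forall>g\<in>{f}. blinfun_apply g v = blinfun_apply g u) \<longrightarrow> v \<in> s"
      using Basis.prems by simp
    with f(2) show ?case by (intro exI[of _ "{f}"] conjI) simp_all
  qed simp
qed

lemma functional_in_span:
  assumes "finite F" "F \<subseteq> P" "P \<subseteq> cdual" "csubspace P"
    and "clinear \<phi>" "\<And>v. (\<forall>f\<in>F. blinfun_apply f v = 0) \<Longrightarrow> \<phi> v = (0::complex)"
  shows "\<exists>h\<in>P. \<phi> = blinfun_apply h"
  using assms(1,2,5,6)
proof (induction F arbitrary: \<phi> rule: finite_induct)
  case empty
  then have "\<phi> = blinfun_apply 0" by auto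
  then show ?case using assms(4) unfolding csubspace_iff by blast
next
  case (insert f F)
  have f: "f \<in> P" "clinear (blinfun_apply f)" using insert.prems assms(3) by (auto simp: cdual_def)
  show ?case
  proof (cases "\<forall>e. (\<forall>g\<in>F. blinfun_apply g e = 0) \<longrightarrow> blinfun_apply f e = 0")
    case True
    have "\<phi> v = 0" if "\<forall>g\<in>F. blinfun_apply g v = 0" for v
      using True that by (intro insert.prems(3)) simp
    then show ?thesis using insert.IH[of \<phi>] insert.prems(1,2) by blast
  next
    case False
    then obtain e where e: "\<forall>g\<in>F. blinfun_apply g e = 0" "blinfun_apply f e \<noteq> 0" by auto
    define c where "c = \<phi> e / blinfun_apply f e"
    define \<psi> where "\<psi> v = \<phi> v - c * blinfun_apply f v" for v
    have "clinear \<psi>"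
      using insert.prems(2) f(2) by (auto simp: \<psi>_def clinear_iff scaleC_complex_def algebra_simps)
    moreover have "\<psi> v = 0" if v: "\<forall>g\<in>F. blinfun_apply g v = 0" for v
    proof -
      define t where "t = blinfun_apply f v / blinfun_apply f e"
      have g: "blinfun_apply g (v + (- t) *\<^sub>C e) = blinfun_apply g v - t * blinfun_apply g e"
        if "g \<in> insert f F" for g
        using that insert.prems(1) assms(3)
        by (auto simp: subset_iff cdual_def clinear_iff scaleC_complex_def)
      have "\<phi> (v + (- t) *\<^sub>C e) = 0"
        using e v g by (intro insert.prems(3)) (auto simp: t_def)
      then have "\<phi> v - t * \<phi> e = 0"
        using insert.prems(2) by (simp add: clinear_iff scaleC_complex_def)
      then show ?thesis by (simp add: \<psi>_def c_def t_def)
    qed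
    ultimately obtain h where "h \<in> P" "\<psi> = blinfun_apply h"
      using insert.IH insert.prems(1) by blast
    then have "\<phi> = blinfun_apply (h + c *\<^sub>C f)"
      by (auto simp: fun_eq_iff \<psi>_def blinfun.add_left scaleC_complex_def algebra_simps)
    then show ?thesis using \<open>h \<in> P\<close> f(1) assms(4) by (auto simp: csubspace_iff)
  qed
qed

lemma weak_star_continuous_functional:
  assumes P: "predual P" and "clinear \<phi>" "continuous_map (weak_star P) euclidean \<phi>"
  shows "\<exists>h\<in>P. \<phi> = blinfun_apply h"
proof -
  have sub: "P \<subseteq> cdual" "csubspace P" using P by (auto simp: predual_def)
  then have "topspace (weak_star P) = UNIV"
    by (auto simp: weak_star_def csubspace_iff intro!: exI[of _ UNIV])
  then have "openin (weak_star P) (\<phi> -` ball 0 1)"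
    using openin_continuous_map_preimage[OF assms(3), of "ball 0 1"] by (simp add: vimage_def)
  moreover have z: "\<phi> 0 = 0"
    using assms(2) unfolding clinear_iff by (metis add_cancel_right_right)
  ultimately obtain F where F: "finite F" "F \<subseteq> P"
    "\<And>v. (\<forall>f\<in>F. blinfun_apply f v = 0) \<Longrightarrow> cmod (\<phi> v) < 1"
    using weak_star_open_kernels[of P "\<phi> -` ball 0 1" 0] by auto
  have "\<phi> v = 0" if v: "\<forall>f\<in>F. blinfun_apply f v = 0" for v
  proof (rule ccontr)
    assume "\<phi> v \<noteq> 0"
    moreover have "\<forall>f\<in>F. blinfun_apply f (inverse (\<phi> v) *\<^sub>C v) = 0"
      using v F(2) sub by (auto simp: subset_iff cdual_def clinear_iff scaleC_complex_def)
    then have "cmod (\<phi> (inverse (\<phi> v) *\<^sub>C v)) < 1" by (rule F(3))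
    ultimately show False using assms(2) by (simp add: clinear_iff scaleC_complex_def)
  qed
  with functional_in_span[OF F(1,2) sub assms(2)] show ?thesis by blast
qed

lemma dual_banach_algebra_mod_ext:
  assumes "normal_dual_banach_bimodule mul P lact ract Q"
  shows "dual_banach_algebra (mod_ext_mul mul lact ract) (mod_ext_predual P Q)"
proof -
  interpret normal_dual_banach_bimodule mul P lact ract Q by fact
  interpret M: banach_algebra "mod_ext_mul mul lact ract"
    by (rule banach_algebra_mod_ext) unfold_locales
  have cs: "csubspace P" "csubspace Q" "Q \<subseteq> cdual"
    using A.predual predual by (auto simp: predual_def)
  have bl: "bounded_bilinear mul" "bounded_bilinear lact" "bounded_bilinear ract"
    "bounded_bilinear (mod_ext_mul mul lact ract)"
    using A.mul_bilinear lact_bilinear ract_bilinear M.mul_bilinear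
    by (simp_all add: bounded_cbilinear_def)
  have cl: "clinear (\<lambda>a. lact a x)" "clinear (\<lambda>a. ract x a)" for x
    using lact_bilinear ract_bilinear by (simp_all add: bounded_cbilinear_def)
  have dl: "blinfun_apply (dual_lact B a f) x = blinfun_apply f (B x a)"
    if "bounded_bilinear B" for B :: "'c::complex_banach \<Rightarrow> 'd::complex_banach \<Rightarrow> 'c" and a f x
    unfolding dual_lact_def
    by (subst bounded_linear_Blinfun_apply) (simp_all add: bounded_linear_compose[OF
      blinfun.bounded_linear_right bounded_bilinear.bounded_linear_left[OF that]])
  have dr: "blinfun_apply (dual_ract B f a) x = blinfun_apply f (B a x)"
    if "bounded_bilinear B" for B :: "'d::complex_banach \<Rightarrow> 'c::complex_banach \<Rightarrow> 'c" and a f x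
    unfolding dual_ract_def
    by (subst bounded_linear_Blinfun_apply) (simp_all add: bounded_linear_compose[OF
      blinfun.bounded_linear_right bounded_bilinear.bounded_linear_right[OF that]])
  have gcont: "continuous_map (weak_star Q) euclidean (blinfun_apply g)" if "g \<in> Q" for g
  proof -
    have "topspace (weak_star Q) = UNIV"
      using that by (auto simp: weak_star_def intro!: exI[of _ UNIV])
    moreover have "openin (weak_star Q) (blinfun_apply g -` U)" if "open U" for U
      unfolding weak_star_def using \<open>g \<in> Q\<close> that by (auto intro!: topology_generated_by_Basis)
    ultimately show ?thesis by (simp add: continuous_map_def vimage_def)
  qed
  have orbit: "\<exists>h\<in>P. \<forall>a. blinfun_apply g (m a) = blinfun_apply h a"
    if "g \<in> Q" "clinear m" "weak_star_continuous P Q m" for g m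
  proof -
    have "clinear (blinfun_apply g \<circ> m)"
      using that cs by (auto simp: clinear_iff cdual_def)
    from weak_star_continuous_functional[OF A.predual this
        continuous_map_compose[OF that(3) gcont[OF that(1)]]]
    show ?thesis by (metis comp_apply)
  qed
  show ?thesis
  proof
    show "predual (mod_ext_predual P Q)" by (rule predual_mod_ext[OF A.predual predual])
    fix F and u :: "('a, 'b) mod_ext" assume "F \<in> mod_ext_predual P Q"
    then obtain f g where F: "F = mod_ext_functional f g" "f \<in> P" "g \<in> Q"
      by (auto simp: mod_ext_predual_def)
    obtain h where h: "h \<in> P" "\<And>a. blinfun_apply g (lact a (mod_part u)) = blinfun_apply h a"
      using orbit[OF F(3) cl(1) lact_weak_star_continuous] by blast
    obtain k where k: "k \<in> P" "\<And>a. blinfun_apply g (ract (mod_part u) a) = blinfun_apply k a"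
      using orbit[OF F(3) cl(2) ract_weak_star_continuous] by blast
    have "dual_lact (mod_ext_mul mul lact ract) u F =
        mod_ext_functional (dual_lact mul (alg_part u) f + h) (dual_lact ract (alg_part u) g)"
      by (rule blinfun_eqI) (simp add: F(1) dl[OF bl(4)] dl[OF bl(1)] dl[OF bl(3)]
        blinfun.add_left mod_ext_mul_def blinfun.add_right h(2))
    moreover have "dual_lact mul (alg_part u) f + h \<in> P" "dual_lact ract (alg_part u) g \<in> Q"
      using A.dual_lact_closed dual_lact_closed F h(1) cs by (auto simp: csubspace_iff)
    ultimately show "dual_lact (mod_ext_mul mul lact ract) u F \<in> mod_ext_predual P Q"
      by (auto simp: mod_ext_predual_def)
    have "dual_ract (mod_ext_mul mul lact ract) F u =
        mod_ext_functional (dual_ract mul f (alg_part u) + k) (dual_ract lact g (alg_part u))"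
      by (rule blinfun_eqI) (simp add: F(1) dr[OF bl(4)] dr[OF bl(1)] dr[OF bl(2)]
        blinfun.add_left mod_ext_mul_def blinfun.add_right k(2))
    moreover have "dual_ract mul f (alg_part u) + k \<in> P" "dual_ract lact g (alg_part u) \<in> Q"
      using A.dual_ract_closed dual_ract_closed F k(1) cs by (auto simp: csubspace_iff)
    ultimately show "dual_ract (mod_ext_mul mul lact ract) F u \<in> mod_ext_predual P Q"
      by (auto simp: mod_ext_predual_def)
  qed
qed

end

theory Submission
  imports Defs
begin

text \<open>
  A linear map on \<open>\<A> \<oplus> X\<close> is a \<open>2 \<times> 2\<close> matrix of linear maps
  \<open>D : \<A> \<rightarrow> \<A>\<close>, \<open>\<Gamma> : X \<rightarrow> \<A>\<close>, \<open>\<delta> : \<A> \<rightarrow> X\<close>, \<open>T : X \<rightarrow> X\<close>, and every notion in the theorem can be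
  read off from the entries. Because \<open>X\<close> squares to zero, the Leibniz rule for the matrix splits
  (\<open>derivation_block_map_iff\<close>) into: \<open>D\<close> and \<open>\<delta>\<close> are derivations, \<open>T\<close> satisfies a Leibniz rule
  along \<open>D\<close>, and \<open>\<Gamma>\<close> is a morphism with \<open>x \<cdot> \<Gamma>(y) + \<Gamma>(x) \<cdot> y = 0\<close>. The matrix is weak*-continuous
  exactly when its four entries are (\<open>weak_star_continuous_block_map_iff\<close>), and the inner derivation
  of \<open>(b, z)\<close> has entries \<open>D = ad\<^sub>b\<close>, \<open>\<Gamma> = 0\<close>, \<open>\<delta> = ad\<^sub>z\<close>, \<open>T(x) = x \<cdot> b - b \<cdot> x\<close>, where
  \<open>ad\<^sub>c(a) = a \<cdot> c - c \<cdot> a\<close> (\<open>inner_derivation_block_map_iff\<close>).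

  If the extension is weakly Connes-amenable, each condition is obtained from a matrix with zeros
  outside the entries it mentions. In the fourth one \<open>D = 0\<close>, and \<open>ad\<^sub>b = 0\<close> is what makes \<open>b\<close>
  central.

  Conversely, the conditions treat \<open>\<Gamma>\<close> and \<open>\<delta>\<close> separately, but the remaining two entries need one
  common element \<open>b\<close>. The first condition gives \<open>D = ad\<^sub>b\<close>; then \<open>T - (x \<mapsto> x \<cdot> b - b \<cdot> x)\<close> is a
  weak*-continuous bimodule morphism, hence of the form \<open>x \<mapsto> x \<cdot> b' - b' \<cdot> x\<close> with \<open>b'\<close> central.
  Replacing \<open>b\<close> by \<open>b + b'\<close> leaves \<open>ad\<^sub>b\<close> unchanged and corrects \<open>T\<close>.
\<close>

section \<open>Weak* continuity through preadjoints\<close>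

lemma weak_star_topspace:
  assumes "predual P"
  shows "topspace (weak_star P) = UNIV"
proof -
  have "0 \<in> P" using assms by (simp add: predual_def csubspace_iff)
  then show ?thesis by (auto simp: weak_star_def intro!: exI[of _ UNIV])
qed

lemma continuous_map_predual_functional:
  assumes "predual P" "f \<in> P"
  shows "continuous_map (weak_star P) euclidean (blinfun_apply f)"
proof -
  have "openin (weak_star P) (blinfun_apply f -` U)" if "open U" for U
    unfolding weak_star_def using assms(2) that by (auto intro!: topology_generated_by_Basis)
  then show ?thesis
    by (simp add: continuous_map_def weak_star_topspace[OF assms(1)] vimage_def)
qed

text \<open>A linear map is weak*-continuous precisely when it has a preadjoint, since the
  weak*-continuous functionals on a dual space are those of the predual. This turns every later
  continuity question into algebra with functionals.\<close>

lemma weak_star_continuous_iff: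
  assumes P: "predual P" and Q: "predual Q" and T: "clinear T"
  shows "weak_star_continuous P Q T \<longleftrightarrow>
    (\<forall>g\<in>Q. \<exists>f\<in>P. \<forall>x. blinfun_apply g (T x) = blinfun_apply f x)"
proof
  assume cont: "weak_star_continuous P Q T"
  show "\<forall>g\<in>Q. \<exists>f\<in>P. \<forall>x. blinfun_apply g (T x) = blinfun_apply f x"
  proof
    fix g assume g: "g \<in> Q"
    then have "clinear (blinfun_apply g)" using Q by (auto simp: predual_def cdual_def)
    then have "clinear (blinfun_apply g \<circ> T)" using T by (simp add: clinear_iff)
    moreover have "continuous_map (weak_star P) euclidean (blinfun_apply g \<circ> T)"
      using cont continuous_map_predual_functional[OF Q g] by (rule continuous_map_compose)
    ultimately obtain f where "f \<in> P" "blinfun_apply g \<circ> T = blinfun_apply f"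
      using weak_star_continuous_functional[OF P] by blast
    then show "\<exists>f\<in>P. \<forall>x. blinfun_apply g (T x) = blinfun_apply f x"
      by (metis comp_apply)
  qed
next
  assume adj: "\<forall>g\<in>Q. \<exists>f\<in>P. \<forall>x. blinfun_apply g (T x) = blinfun_apply f x"
  have "openin (weak_star P) (T -` (blinfun_apply g -` U))" if g: "g \<in> Q" and U: "open U" for g U
  proof -
    obtain f where f: "f \<in> P" "\<And>x. blinfun_apply g (T x) = blinfun_apply f x"
      using adj g by blast
    then have "T -` (blinfun_apply g -` U) = blinfun_apply f -` U" by auto
    then show ?thesis
      unfolding weak_star_def using f(1) U by (auto intro!: topology_generated_by_Basis)
  qed
  moreover have "\<Union>{blinfun_apply g -` U |g U. g \<in> Q \<and> open U} = UNIV"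
    using weak_star_topspace[OF Q] by (simp add: weak_star_def)
  ultimately show "weak_star_continuous P Q T"
    unfolding weak_star_def[of Q]
    by (intro continuous_on_generated_topo) (auto simp: weak_star_topspace[OF P])
qed

lemma clinear_zero_map: "clinear (\<lambda>_. 0)"
  by (simp add: clinear_iff) (metis scaleC_add_right add_cancel_right_right)

lemma clinear_diff:
  assumes "clinear S" "clinear T"
  shows "clinear (\<lambda>x. S x - T x)"
proof -
  have "c *\<^sub>C (y - z) = c *\<^sub>C y - c *\<^sub>C z" for c and y z :: "'b"
    by (metis scaleC_add_right add_diff_cancel diff_add_cancel)
  then show ?thesis using assms by (simp add: clinear_iff)
qed

lemma weak_star_continuous_zero_map:
  assumes "predual P" "predual Q"
  shows "weak_star_continuous P Q (\<lambda>_. 0)"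
proof -
  have "0 \<in> P" using assms(1) by (simp add: predual_def csubspace_iff)
  then show ?thesis
    unfolding weak_star_continuous_iff[OF assms clinear_zero_map]
    by (auto simp: blinfun.zero_right intro!: bexI[of _ 0])
qed

lemma weak_star_continuous_diff:
  assumes P: "predual P" and Q: "predual Q" and lin: "clinear S" "clinear T"
    and cont: "weak_star_continuous P Q S" "weak_star_continuous P Q T"
  shows "weak_star_continuous P Q (\<lambda>x. S x - T x)"
  unfolding weak_star_continuous_iff[OF P Q clinear_diff[OF lin]]
proof
  fix g assume "g \<in> Q"
  then obtain f h where fh: "f \<in> P" "h \<in> P"
    "\<And>x. blinfun_apply g (S x) = blinfun_apply f x" "\<And>x. blinfun_apply g (T x) = blinfun_apply h x"
    using cont unfolding weak_star_continuous_iff[OF P Q lin(1)]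
      weak_star_continuous_iff[OF P Q lin(2)] by blast
  have "f + (-1) *\<^sub>C h \<in> P" using P fh by (simp add: predual_def csubspace_iff)
  moreover have "blinfun_apply g (S x - T x) = blinfun_apply (f + (-1) *\<^sub>C h) x" for x
    by (simp add: blinfun.diff_right blinfun.add_left fh scaleC_complex_def)
  ultimately show "\<exists>f\<in>P. \<forall>x. blinfun_apply g (S x - T x) = blinfun_apply f x" by blast
qed

text \<open>Unlike continuity of the action in the algebra variable, which is normality, continuity in
  the module variable holds in every dual bimodule: the preadjoints are the dual actions.\<close>

lemma (in dual_banach_bimodule) weak_star_continuous_actions:
  shows "weak_star_continuous Q Q (lact b)" "weak_star_continuous Q Q (\<lambda>x. ract x b)"
proof -
  have bl: "bounded_bilinear lact" "bounded_bilinear ract"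
    and cl: "clinear (lact b)" "clinear (\<lambda>x. ract x b)"
    using lact_bilinear ract_bilinear by (simp_all add: bounded_cbilinear_def)
  have "blinfun_apply (dual_ract lact g b) x = blinfun_apply g (lact b x)" for g x
    unfolding dual_ract_def
    by (subst bounded_linear_Blinfun_apply) (simp_all add: bounded_linear_compose[OF
      blinfun.bounded_linear_right bounded_bilinear.bounded_linear_right[OF bl(1)]])
  then show "weak_star_continuous Q Q (lact b)"
    unfolding weak_star_continuous_iff[OF predual predual cl(1)]
    using dual_ract_closed by metis
  have "blinfun_apply (dual_lact ract b g) x = blinfun_apply g (ract x b)" for g x
    unfolding dual_lact_def
    by (subst bounded_linear_Blinfun_apply) (simp_all add: bounded_linear_compose[OF
      blinfun.bounded_linear_right bounded_bilinear.bounded_linear_left[OF bl(2)]])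
  then show "weak_star_continuous Q Q (\<lambda>x. ract x b)"
    unfolding weak_star_continuous_iff[OF predual predual cl(2)]
    using dual_lact_closed by metis
qed


section \<open>Linear maps of a module extension as block matrices\<close>

definition block_map ::
    "('a \<Rightarrow> 'a) \<Rightarrow> ('x \<Rightarrow> 'a) \<Rightarrow> ('a \<Rightarrow> 'x) \<Rightarrow> ('x \<Rightarrow> 'x) \<Rightarrow>
     ('a::complex_banach, 'x::complex_banach) mod_ext \<Rightarrow> ('a, 'x) mod_ext" where
  "block_map D \<Gamma> \<delta> T u =
     Mod_Ext (D (alg_part u) + \<Gamma> (mod_part u)) (\<delta> (alg_part u) + T (mod_part u))"

lemma clinear_zero: "clinear f \<Longrightarrow> f 0 = 0"
  unfolding clinear_iff by (metis add_cancel_right_right)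

lemma clinear_block_map:
  assumes "clinear D" "clinear \<Gamma>" "clinear \<delta>" "clinear T"
  shows "clinear (block_map D \<Gamma> \<delta> T)"
  using assms
  by (auto intro!: mod_ext.expand simp: block_map_def clinear_iff scaleC_add_right)

lemma clinear_block_mapE:
  assumes "clinear E"
  obtains D \<Gamma> \<delta> T where "clinear D" "clinear \<Gamma>" "clinear \<delta>" "clinear T"
    "E = block_map D \<Gamma> \<delta> T"
proof
  have add: "E (u + v) = E u + E v" and scale: "E (c *\<^sub>C u) = c *\<^sub>C E u" for u v c
    using assms by (simp_all add: clinear_iff)
  have z: "c *\<^sub>C (0::'c::complex_banach) = 0" for c
    by (metis scaleC_add_right add_cancel_right_right)
  have inc: "Mod_Ext (a + a') 0 = Mod_Ext a 0 + Mod_Ext a' 0"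
    "Mod_Ext 0 (x + x') = Mod_Ext 0 x + Mod_Ext 0 x'"
    "Mod_Ext (c *\<^sub>C a) 0 = c *\<^sub>C Mod_Ext a 0" "Mod_Ext 0 (c *\<^sub>C x) = c *\<^sub>C Mod_Ext 0 x"
    for a a' :: 'a and x x' :: 'b and c
    by (simp_all add: plus_mod_ext_def scaleC_mod_ext_def z)
  show "clinear (\<lambda>a. alg_part (E (Mod_Ext a 0)))" "clinear (\<lambda>x. alg_part (E (Mod_Ext 0 x)))"
    "clinear (\<lambda>a. mod_part (E (Mod_Ext a 0)))" "clinear (\<lambda>x. mod_part (E (Mod_Ext 0 x)))"
    by (simp_all only: clinear_iff inc add scale mod_ext_sel mod_ext_sel_scaleC simp_thms)
  show "E = block_map (\<lambda>a. alg_part (E (Mod_Ext a 0))) (\<lambda>x. alg_part (E (Mod_Ext 0 x)))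
      (\<lambda>a. mod_part (E (Mod_Ext a 0))) (\<lambda>x. mod_part (E (Mod_Ext 0 x)))"
  proof
    fix u
    have "E u = E (Mod_Ext (alg_part u) 0) + E (Mod_Ext 0 (mod_part u))"
      by (subst add[symmetric]) (simp add: plus_mod_ext_def)
    then show "E u = block_map (\<lambda>a. alg_part (E (Mod_Ext a 0))) (\<lambda>x. alg_part (E (Mod_Ext 0 x)))
        (\<lambda>a. mod_part (E (Mod_Ext a 0))) (\<lambda>x. mod_part (E (Mod_Ext 0 x))) u"
      by (simp add: block_map_def plus_mod_ext_def)
  qed
qed

text \<open>A functional in the predual of the extension is a pair of functionals in the two preduals, so
  preadjoints of a block matrix are block matrices of preadjoints.\<close>

lemma weak_star_continuous_block_map_iff:
  assumes P: "predual P" and Q: "predual Q"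
    and lin: "clinear D" "clinear \<Gamma>" "clinear \<delta>" "clinear T"
  shows "weak_star_continuous (mod_ext_predual P Q) (mod_ext_predual P Q) (block_map D \<Gamma> \<delta> T) \<longleftrightarrow>
    weak_star_continuous P P D \<and> weak_star_continuous Q P \<Gamma> \<and>
    weak_star_continuous P Q \<delta> \<and> weak_star_continuous Q Q T"
    (is "?L \<longleftrightarrow> ?R")
proof -
  let ?M = "block_map D \<Gamma> \<delta> T" and ?F = mod_ext_functional
  note R = predual_mod_ext[OF P Q]
  have zero: "0 \<in> P" "0 \<in> Q"
    using P Q by (simp_all add: predual_def csubspace_iff)
  have add: "f + f' \<in> P" "g + g' \<in> Q" if "f \<in> P" "f' \<in> P" "g \<in> Q" "g' \<in> Q" for f f' g g'
    using P Q that by (simp_all add: predual_def csubspace_iff)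
  note z = lin[THEN clinear_zero]
  have L_iff: "?L \<longleftrightarrow> (\<forall>f\<in>P. \<forall>g\<in>Q. \<exists>h\<in>P. \<exists>k\<in>Q. \<forall>a x.
      blinfun_apply f (D a + \<Gamma> x) + blinfun_apply g (\<delta> a + T x) =
      blinfun_apply h a + blinfun_apply k x)"
    unfolding weak_star_continuous_iff[OF R R clinear_block_map[OF lin]]
  proof (intro iffI ballI)
    fix f g assume "f \<in> P" "g \<in> Q" and *: "\<forall>g\<in>mod_ext_predual P Q. \<exists>f\<in>mod_ext_predual P Q.
      \<forall>x. blinfun_apply g (?M x) = blinfun_apply f x"
    then obtain h k where hk: "h \<in> P" "k \<in> Q"
      "\<And>u. blinfun_apply (?F f g) (?M u) = blinfun_apply (?F h k) u"
      unfolding mod_ext_predual_def by blast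
    have "blinfun_apply f (D a + \<Gamma> x) + blinfun_apply g (\<delta> a + T x) =
        blinfun_apply h a + blinfun_apply k x" for a x
      using hk(3)[of "Mod_Ext a x"] by (simp add: block_map_def)
    with hk(1,2) show "\<exists>h\<in>P. \<exists>k\<in>Q. \<forall>a x.
        blinfun_apply f (D a + \<Gamma> x) + blinfun_apply g (\<delta> a + T x) =
        blinfun_apply h a + blinfun_apply k x" by blast
  next
    fix F assume *: "\<forall>f\<in>P. \<forall>g\<in>Q. \<exists>h\<in>P. \<exists>k\<in>Q. \<forall>a x.
      blinfun_apply f (D a + \<Gamma> x) + blinfun_apply g (\<delta> a + T x) =
      blinfun_apply h a + blinfun_apply k x" and "F \<in> mod_ext_predual P Q"
    then obtain f g where fg: "F = ?F f g" "f \<in> P" "g \<in> Q" by (auto simp: mod_ext_predual_def)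
    with * obtain h k where hk: "h \<in> P" "k \<in> Q" "\<And>a x.
      blinfun_apply f (D a + \<Gamma> x) + blinfun_apply g (\<delta> a + T x) =
      blinfun_apply h a + blinfun_apply k x" by blast
    have "blinfun_apply F (?M u) = blinfun_apply (?F h k) u" for u
      using hk(3) by (simp add: fg(1) block_map_def)
    moreover have "?F h k \<in> mod_ext_predual P Q" using hk(1,2) by (auto simp: mod_ext_predual_def)
    ultimately show "\<exists>f\<in>mod_ext_predual P Q. \<forall>x. blinfun_apply F (?M x) = blinfun_apply f x"
      by blast
  qed
  show ?thesis
  proof
    assume ?L
    then have *: "\<exists>h\<in>P. \<exists>k\<in>Q. \<forall>a x.
        blinfun_apply f (D a + \<Gamma> x) + blinfun_apply g (\<delta> a + T x) =
        blinfun_apply h a + blinfun_apply k x" if "f \<in> P" "g \<in> Q" for f g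
      using that unfolding L_iff by blast
    have f: "\<exists>h\<in>P. \<exists>k\<in>Q. (\<forall>a. blinfun_apply f (D a) = blinfun_apply h a) \<and>
        (\<forall>x. blinfun_apply f (\<Gamma> x) = blinfun_apply k x)" if f: "f \<in> P" for f
    proof -
      obtain h k where "h \<in> P" "k \<in> Q" and hk: "\<And>a x. blinfun_apply f (D a + \<Gamma> x) +
          blinfun_apply 0 (\<delta> a + T x) = blinfun_apply h a + blinfun_apply k x"
        using *[OF f zero(2)] by blast
      moreover have "blinfun_apply f (D a) = blinfun_apply h a"
        "blinfun_apply f (\<Gamma> x) = blinfun_apply k x" for a x
        using hk[of a 0] hk[of 0 x] by (simp_all add: z blinfun.zero_right)
      ultimately show ?thesis by blast
    qed
    have g: "\<exists>h\<in>P. \<exists>k\<in>Q. (\<forall>a. blinfun_apply g (\<delta> a) = blinfun_apply h a) \<and>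
        (\<forall>x. blinfun_apply g (T x) = blinfun_apply k x)" if g: "g \<in> Q" for g
    proof -
      obtain h k where "h \<in> P" "k \<in> Q" and hk: "\<And>a x. blinfun_apply 0 (D a + \<Gamma> x) +
          blinfun_apply g (\<delta> a + T x) = blinfun_apply h a + blinfun_apply k x"
        using *[OF zero(1) g] by blast
      moreover have "blinfun_apply g (\<delta> a) = blinfun_apply h a"
        "blinfun_apply g (T x) = blinfun_apply k x" for a x
        using hk[of a 0] hk[of 0 x] by (simp_all add: z blinfun.zero_right)
      ultimately show ?thesis by blast
    qed
    show ?R
      using f g by (simp add: weak_star_continuous_iff[OF P P] weak_star_continuous_iff[OF P Q]
        weak_star_continuous_iff[OF Q P] weak_star_continuous_iff[OF Q Q] lin)
  next
    assume ?R
    then have adj: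
      "f \<in> P \<Longrightarrow> \<exists>h\<in>P. \<forall>a. blinfun_apply f (D a) = blinfun_apply h a"
      "f \<in> P \<Longrightarrow> \<exists>k\<in>Q. \<forall>x. blinfun_apply f (\<Gamma> x) = blinfun_apply k x"
      "g \<in> Q \<Longrightarrow> \<exists>h\<in>P. \<forall>a. blinfun_apply g (\<delta> a) = blinfun_apply h a"
      "g \<in> Q \<Longrightarrow> \<exists>k\<in>Q. \<forall>x. blinfun_apply g (T x) = blinfun_apply k x" for f g
      by (simp_all add: weak_star_continuous_iff[OF P P] weak_star_continuous_iff[OF P Q]
        weak_star_continuous_iff[OF Q P] weak_star_continuous_iff[OF Q Q] lin)
    show ?L unfolding L_iff
    proof (intro ballI)
      fix f g assume fg: "f \<in> P" "g \<in> Q"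
      obtain h h' k k' where hk: "h \<in> P" "h' \<in> P" "k \<in> Q" "k' \<in> Q"
        "\<And>a. blinfun_apply f (D a) = blinfun_apply h a"
        "\<And>x. blinfun_apply f (\<Gamma> x) = blinfun_apply k x"
        "\<And>a. blinfun_apply g (\<delta> a) = blinfun_apply h' a"
        "\<And>x. blinfun_apply g (T x) = blinfun_apply k' x"
        using adj(1,2)[OF fg(1)] adj(3,4)[OF fg(2)] by metis
      have "blinfun_apply f (D a + \<Gamma> x) + blinfun_apply g (\<delta> a + T x) =
          blinfun_apply (h + h') a + blinfun_apply (k + k') x" for a x
        by (simp add: blinfun.add_left blinfun.add_right hk)
      then show "\<exists>h\<in>P. \<exists>k\<in>Q. \<forall>a x.
          blinfun_apply f (D a + \<Gamma> x) + blinfun_apply g (\<delta> a + T x) =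
          blinfun_apply h a + blinfun_apply k x"
        using add[OF hk(1,2,3,4)] by blast
    qed
  qed
qed


section \<open>Derivations of a module extension\<close>

definition derivation_along ::
    "('a \<Rightarrow> 'x \<Rightarrow> 'x) \<Rightarrow> ('x \<Rightarrow> 'a \<Rightarrow> 'x) \<Rightarrow> ('a \<Rightarrow> 'a) \<Rightarrow> ('x::complex_banach \<Rightarrow> 'x) \<Rightarrow> bool" where
  "derivation_along lact ract D T \<longleftrightarrow> clinear T \<and>
     (\<forall>a x. T (lact a x) = lact (D a) x + lact a (T x)) \<and>
     (\<forall>a x. T (ract x a) = ract x (D a) + ract (T x) a)"

context banach_bimodule
begin

lemma actions_clinear:
  "clinear (mul a)" "clinear (\<lambda>a. mul a b)" "clinear (lact a)" "clinear (\<lambda>a. lact a x)"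
  "clinear (ract x)" "clinear (\<lambda>x. ract x a)"
  using mul_bilinear lact_bilinear ract_bilinear by (simp_all add: bounded_cbilinear_def)

lemma actions_add:
  "mul (a + b) c = mul a c + mul b c" "mul a (b + c) = mul a b + mul a c"
  "lact (a + b) x = lact a x + lact b x" "lact a (x + y) = lact a x + lact a y"
  "ract x (a + b) = ract x a + ract x b" "ract (x + y) a = ract x a + ract y a"
  using actions_clinear by (simp_all add: clinear_iff)

lemma actions_zero:
  "mul 0 a = 0" "mul a 0 = 0" "lact 0 x = 0" "lact a 0 = 0" "ract x 0 = 0" "ract 0 a = 0"
  using actions_clinear[THEN clinear_zero] by simp_all

lemma actions_diff:
  "mul (a - b) c = mul a c - mul b c" "mul a (b - c) = mul a b - mul a c"
  "lact (a - b) x = lact a x - lact b x" "lact a (x - y) = lact a x - lact a y"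
  "ract x (a - b) = ract x a - ract x b" "ract (x - y) a = ract x a - ract y a"
  using actions_add by (metis add_diff_cancel diff_add_cancel)+

lemma mod_ext_mul_eq:
  "mod_ext_mul mul lact ract (Mod_Ext a x) (Mod_Ext b y) =
     Mod_Ext (mul a b) (lact a y + ract x b)"
  by (simp add: mod_ext_mul_def)

text \<open>Both sides of the Leibniz rule are biadditive, so it holds once it holds on
  \<open>\<A> \<times> \<A>\<close>, \<open>\<A> \<times> X\<close>, \<open>X \<times> \<A>\<close> and \<open>X \<times> X\<close>. The four cases give the conditions on the entries;
  the last one, where the product vanishes, is the equation \<open>x \<cdot> \<Gamma>(y) + \<Gamma>(x) \<cdot> y = 0\<close>.\<close>

lemma derivation_block_map_iff:
  assumes lin: "clinear D" "clinear \<Gamma>" "clinear \<delta>" "clinear T"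
  defines "m \<equiv> mod_ext_mul mul lact ract"
  shows "derivation m m m (block_map D \<Gamma> \<delta> T) \<longleftrightarrow>
    derivation mul mul mul D \<and> derivation mul lact ract \<delta> \<and> derivation_along lact ract D T \<and>
    bimodule_morphism lact ract mul mul \<Gamma> \<and> (\<forall>x y. ract x (\<Gamma> y) + lact (\<Gamma> x) y = 0)"
    (is "?L \<longleftrightarrow> ?R")
proof
  note z = lin[THEN clinear_zero]
  let ?E = "block_map D \<Gamma> \<delta> T"
  assume ?L
  then have leib: "?E (m u v) = m (?E u) v + m u (?E v)" for u v
    by (simp add: derivation_def)
  note eqs = m_def mod_ext_mul_eq block_map_def z actions_zero plus_mod_ext_def
  have "D (mul a b) = mul (D a) b + mul a (D b)" "\<delta> (mul a b) = ract (\<delta> a) b + lact a (\<delta> b)" for a b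
    using leib[of "Mod_Ext a 0" "Mod_Ext b 0"] by (simp_all add: eqs add.commute)
  moreover have "\<Gamma> (lact a x) = mul a (\<Gamma> x)" "T (lact a x) = lact (D a) x + lact a (T x)" for a x
    using leib[of "Mod_Ext a 0" "Mod_Ext 0 x"] by (simp_all add: eqs add.commute)
  moreover have "\<Gamma> (ract x a) = mul (\<Gamma> x) a" "T (ract x a) = ract x (D a) + ract (T x) a" for a x
    using leib[of "Mod_Ext 0 x" "Mod_Ext a 0"] by (simp_all add: eqs add.commute)
  moreover have "ract x (\<Gamma> y) + lact (\<Gamma> x) y = 0" for x y
    using leib[of "Mod_Ext 0 x" "Mod_Ext 0 y"] by (simp add: eqs add.commute)
  ultimately show ?R
    using lin by (simp add: derivation_def derivation_along_def bimodule_morphism_def)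
next
  assume ?R
  then have rules:
    "D (mul a b) = mul (D a) b + mul a (D b)" "\<delta> (mul a b) = ract (\<delta> a) b + lact a (\<delta> b)"
    "\<Gamma> (lact a x) = mul a (\<Gamma> x)" "T (lact a x) = lact (D a) x + lact a (T x)"
    "\<Gamma> (ract x a) = mul (\<Gamma> x) a" "T (ract x a) = ract x (D a) + ract (T x) a"
    and anti: "lact (\<Gamma> x) y = - ract x (\<Gamma> y)" for a b x y
    by (simp_all add: derivation_def derivation_along_def bimodule_morphism_def
      eq_neg_iff_add_eq_0 add.commute)
  have "\<Gamma> (x + y) = \<Gamma> x + \<Gamma> y" "T (x + y) = T x + T y" for x y
    using lin by (simp_all add: clinear_iff)
  then have "block_map D \<Gamma> \<delta> T (m u v) =
      m (block_map D \<Gamma> \<delta> T u) v + m u (block_map D \<Gamma> \<delta> T v)" for u v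
    by (intro mod_ext.expand)
      (simp add: m_def block_map_def mod_ext_mul_def rules actions_add anti)
  then show ?L
    using clinear_block_map[OF lin] by (simp add: derivation_def)
qed

lemma inner_derivation_block_map_iff:
  assumes lin: "clinear D" "clinear \<Gamma>" "clinear \<delta>" "clinear T"
  defines "m \<equiv> mod_ext_mul mul lact ract"
  shows "inner_derivation m m (block_map D \<Gamma> \<delta> T) \<longleftrightarrow>
    \<Gamma> = (\<lambda>_. 0) \<and> inner_derivation lact ract \<delta> \<and>
    (\<exists>b. (\<forall>a. D a = mul a b - mul b a) \<and> (\<forall>x. T x = ract x b - lact b x))"
    (is "?L \<longleftrightarrow> ?R")
proof
  note z = lin[THEN clinear_zero]
  assume ?L
  then obtain w where "\<And>u. block_map D \<Gamma> \<delta> T u = m u w - m w u"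
    by (auto simp: inner_derivation_def)
  moreover obtain b y where "w = Mod_Ext b y" by (cases w)
  ultimately have *: "block_map D \<Gamma> \<delta> T (Mod_Ext a x) =
      Mod_Ext (mul a b - mul b a) ((lact a y + ract x b) - (lact b x + ract y a))" for a x
    by (simp add: m_def mod_ext_mul_eq minus_mod_ext_def)
  have "D a = mul a b - mul b a" "\<delta> a = lact a y - ract y a" for a
    using *[of a 0] by (simp_all add: block_map_def z actions_zero)
  moreover have "\<Gamma> x = 0" "T x = ract x b - lact b x" for x
    using *[of 0 x] by (simp_all add: block_map_def z actions_zero)
  ultimately show ?R by (auto simp: inner_derivation_def)
next
  assume ?R
  then obtain b y where "\<And>x. \<Gamma> x = 0" "\<And>a. \<delta> a = lact a y - ract y a"
    "\<And>a. D a = mul a b - mul b a" "\<And>x. T x = ract x b - lact b x"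
    by (auto simp: inner_derivation_def)
  then have "block_map D \<Gamma> \<delta> T u = m u (Mod_Ext b y) - m (Mod_Ext b y) u" for u
    by (intro mod_ext.expand) (simp add: block_map_def m_def mod_ext_mul_def)
  then show ?L by (auto simp: inner_derivation_def)
qed

text \<open>Two maps with the Leibniz rule along the same derivation differ by a bimodule morphism, and
  \<open>x \<mapsto> x \<cdot> b - b \<cdot> x\<close> obeys the rule along \<open>ad\<^sub>b\<close>.\<close>

lemma derivation_along_inner_minus_morphism:
  assumes "derivation_along lact ract D T" "\<And>a. D a = mul a b - mul b a"
  shows "bimodule_morphism lact ract lact ract (\<lambda>x. T x - (ract x b - lact b x))"
  using assms clinear_diff[OF _ clinear_diff[OF actions_clinear(6,3)]]
  by (auto simp: derivation_along_def bimodule_morphism_def actions_diff lact_lact ract_ract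
    lact_ract)

lemma derivation_zero: "derivation mul lact ract (\<lambda>_. 0)"
  by (simp add: derivation_def clinear_zero_map actions_zero)

lemma derivation_along_zero_iff:
  "derivation_along lact ract (\<lambda>_. 0) T \<longleftrightarrow> bimodule_morphism lact ract lact ract T"
  by (auto simp: derivation_along_def bimodule_morphism_def actions_zero)

end

lemma (in banach_algebra) regular_bimodule: "banach_bimodule mul mul mul"
  by unfold_locales (simp_all add: mul_bilinear mul_assoc)

text \<open>Weak Connes-amenability of the extension, entry by entry. The diagonal entries \<open>D\<close> and \<open>T\<close>
  stay coupled because one element \<open>b\<close> has to serve for both.\<close>

lemma (in normal_dual_banach_bimodule) weakly_connes_amenable_mod_ext_iff:
  "weakly_connes_amenable (mod_ext_mul mul lact ract) (mod_ext_predual P Q) \<longleftrightarrow>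
    (\<forall>D \<Gamma> \<delta> T. derivation mul mul mul D \<and> weak_star_continuous P P D \<and>
       bimodule_morphism lact ract mul mul \<Gamma> \<and> weak_star_continuous Q P \<Gamma> \<and>
       (\<forall>x y. ract x (\<Gamma> y) + lact (\<Gamma> x) y = 0) \<and>
       derivation mul lact ract \<delta> \<and> weak_star_continuous P Q \<delta> \<and>
       derivation_along lact ract D T \<and> weak_star_continuous Q Q T \<longrightarrow>
       \<Gamma> = (\<lambda>_. 0) \<and> inner_derivation lact ract \<delta> \<and>
       (\<exists>b. (\<forall>a. D a = mul a b - mul b a) \<and> (\<forall>x. T x = ract x b - lact b x)))"
    (is "?L \<longleftrightarrow> ?R")
proof
  assume L: ?L
  show ?R
  proof (intro allI impI)
    fix D \<Gamma> \<delta> T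
    assume H: "derivation mul mul mul D \<and> weak_star_continuous P P D \<and>
       bimodule_morphism lact ract mul mul \<Gamma> \<and> weak_star_continuous Q P \<Gamma> \<and>
       (\<forall>x y. ract x (\<Gamma> y) + lact (\<Gamma> x) y = 0) \<and>
       derivation mul lact ract \<delta> \<and> weak_star_continuous P Q \<delta> \<and>
       derivation_along lact ract D T \<and> weak_star_continuous Q Q T"
    then have lin: "clinear D" "clinear \<Gamma>" "clinear \<delta>" "clinear T"
      by (simp_all add: derivation_def bimodule_morphism_def derivation_along_def)
    show "\<Gamma> = (\<lambda>_. 0) \<and> inner_derivation lact ract \<delta> \<and>
       (\<exists>b. (\<forall>a. D a = mul a b - mul b a) \<and> (\<forall>x. T x = ract x b - lact b x))"
      using L H unfolding weakly_connes_amenable_def H1_weak_star_trivial_def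
      by (simp add: derivation_block_map_iff[OF lin] inner_derivation_block_map_iff[OF lin, symmetric]
        weak_star_continuous_block_map_iff[OF A.predual predual lin])
  qed
next
  assume R: ?R
  show ?L
    unfolding weakly_connes_amenable_def H1_weak_star_trivial_def
  proof (intro allI impI, elim conjE)
    let ?m = "mod_ext_mul mul lact ract"
    fix E assume E: "derivation ?m ?m ?m E"
      "weak_star_continuous (mod_ext_predual P Q) (mod_ext_predual P Q) E"
    then have "clinear E" by (simp add: derivation_def)
    then obtain D \<Gamma> \<delta> T where lin: "clinear D" "clinear \<Gamma>" "clinear \<delta>" "clinear T"
      and E_eq: "E = block_map D \<Gamma> \<delta> T" by (rule clinear_block_mapE)
    show "inner_derivation ?m ?m E"
      using R E unfolding E_eq derivation_block_map_iff[OF lin] inner_derivation_block_map_iff[OF lin]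
        weak_star_continuous_block_map_iff[OF A.predual predual lin]
      by blast
  qed
qed


theorem theorem2p3:
  fixes mul :: "'a::complex_banach \<Rightarrow> 'a \<Rightarrow> 'a"
    and P :: "('a \<Rightarrow>\<^sub>L complex) set"
    and lact :: "'a \<Rightarrow> 'x::complex_banach \<Rightarrow> 'x"
    and ract :: "'x \<Rightarrow> 'a \<Rightarrow> 'x"
    and Q :: "('x \<Rightarrow>\<^sub>L complex) set"
  assumes "dual_banach_algebra mul P"
    and "normal_dual_banach_bimodule mul P lact ract Q"
  shows "weakly_connes_amenable (mod_ext_mul mul lact ract) (mod_ext_predual P Q) \<longleftrightarrow>
    (\<forall>D. derivation mul mul mul D \<and> weak_star_continuous P P D \<and>
         (\<exists>T. clinear T \<and> weak_star_continuous Q Q T \<and>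
              (\<forall>a x. T (lact a x) = lact (D a) x + lact a (T x)) \<and>
              (\<forall>a x. T (ract x a) = ract x (D a) + ract (T x) a))
       \<longrightarrow> inner_derivation mul mul D) \<and>
    H1_weak_star_trivial mul P lact ract Q \<and>
    (\<forall>\<Gamma>. bimodule_morphism lact ract mul mul \<Gamma> \<and> weak_star_continuous Q P \<Gamma> \<and>
         (\<forall>x y. ract x (\<Gamma> y) + lact (\<Gamma> x) y = 0)
       \<longrightarrow> \<Gamma> = (\<lambda>_. 0)) \<and>
    (\<forall>T. bimodule_morphism lact ract lact ract T \<and> weak_star_continuous Q Q T
       \<longrightarrow> (\<exists>b. (\<forall>a. mul a b = mul b a) \<and> (\<forall>x. T x = ract x b - lact b x)))"
    (is "?WCA \<longleftrightarrow> ?C1 \<and> ?C2 \<and> ?C3 \<and> ?C4")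
proof -
  interpret normal_dual_banach_bimodule mul P lact ract Q by fact
  interpret reg: banach_bimodule mul mul mul by (rule A.regular_bimodule)
  note wc0 = weak_star_continuous_zero_map[OF A.predual A.predual]
    weak_star_continuous_zero_map[OF A.predual predual]
    weak_star_continuous_zero_map[OF predual A.predual]
    weak_star_continuous_zero_map[OF predual predual]
  have \<Gamma>0: "bimodule_morphism lact ract mul mul (\<lambda>_. 0)"
    by (simp add: bimodule_morphism_def clinear_zero_map reg.actions_zero)
  have T0: "derivation_along lact ract (\<lambda>_. 0) (\<lambda>_. 0)"
    by (simp add: derivation_along_def clinear_zero_map actions_zero)
  note zeros = wc0 \<Gamma>0 T0 derivation_zero reg.derivation_zero actions_zero
  show ?thesis
  proof (intro iffI conjI)
    assume ?WCA
    note W = this[unfolded weakly_connes_amenable_mod_ext_iff, rule_format]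
    show ?C1
    proof (intro allI impI, elim conjE exE)
      fix D T
      assume "derivation mul mul mul D" "weak_star_continuous P P D" "clinear T"
        "weak_star_continuous Q Q T" "\<forall>a x. T (lact a x) = lact (D a) x + lact a (T x)"
        "\<forall>a x. T (ract x a) = ract x (D a) + ract (T x) a"
      then have "\<exists>b. (\<forall>a. D a = mul a b - mul b a) \<and> (\<forall>x. T x = ract x b - lact b x)"
        using W[of D "\<lambda>_. 0" "\<lambda>_. 0" T] zeros by (simp add: derivation_along_def)
      then show "inner_derivation mul mul D" by (auto simp: inner_derivation_def)
    qed
    show ?C2
      unfolding H1_weak_star_trivial_def
    proof (intro allI impI)
      fix \<delta> assume "derivation mul lact ract \<delta> \<and> weak_star_continuous P Q \<delta>"
      then show "inner_derivation lact ract \<delta>"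
        using W[of "\<lambda>_. 0" "\<lambda>_. 0" \<delta> "\<lambda>_. 0"] zeros by simp
    qed
    show ?C3
    proof (intro allI impI)
      fix \<Gamma> assume "bimodule_morphism lact ract mul mul \<Gamma> \<and> weak_star_continuous Q P \<Gamma> \<and>
        (\<forall>x y. ract x (\<Gamma> y) + lact (\<Gamma> x) y = 0)"
      then show "\<Gamma> = (\<lambda>_. 0)"
        using W[of "\<lambda>_. 0" \<Gamma> "\<lambda>_. 0" "\<lambda>_. 0"] zeros by simp
    qed
    show ?C4
    proof (intro allI impI)
      fix T assume "bimodule_morphism lact ract lact ract T \<and> weak_star_continuous Q Q T"
      then have "\<exists>b. (\<forall>a. 0 = mul a b - mul b a) \<and> (\<forall>x. T x = ract x b - lact b x)"
        using W[of "\<lambda>_. 0" "\<lambda>_. 0" "\<lambda>_. 0" T] zeros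
        by (simp add: derivation_along_zero_iff)
      then show "\<exists>b. (\<forall>a. mul a b = mul b a) \<and> (\<forall>x. T x = ract x b - lact b x)"
        by simp
    qed
  next
    assume C: "?C1 \<and> ?C2 \<and> ?C3 \<and> ?C4"
    note C1 = C[THEN conjunct1] and C2 = C[THEN conjunct2, THEN conjunct1]
      and C3 = C[THEN conjunct2, THEN conjunct2, THEN conjunct1]
      and C4 = C[THEN conjunct2, THEN conjunct2, THEN conjunct2]
    show ?WCA
      unfolding weakly_connes_amenable_mod_ext_iff
    proof (intro allI impI, elim conjE, intro conjI)
      fix D \<Gamma> \<delta> T
      assume D: "derivation mul mul mul D" "weak_star_continuous P P D"
        and \<Gamma>: "bimodule_morphism lact ract mul mul \<Gamma>" "weak_star_continuous Q P \<Gamma>"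
          "\<forall>x y. ract x (\<Gamma> y) + lact (\<Gamma> x) y = 0"
        and \<delta>: "derivation mul lact ract \<delta>" "weak_star_continuous P Q \<delta>"
        and T: "derivation_along lact ract D T" "weak_star_continuous Q Q T"
      show "\<Gamma> = (\<lambda>_. 0)" using C3 \<Gamma> by blast
      show "inner_derivation lact ract \<delta>" using C2 \<delta> by (simp add: H1_weak_star_trivial_def)
      have "inner_derivation mul mul D"
        using C1 D T unfolding derivation_along_def by blast
      then obtain b where b: "\<And>a. D a = mul a b - mul b a"
        by (auto simp: inner_derivation_def)
      \<comment> \<open>\<open>b\<close> was chosen for \<open>D\<close> alone. The fourth condition describes its error on \<open>X\<close> by a
        central \<open>b'\<close>, and centrality lets \<open>b + b'\<close> still implement \<open>D\<close>.\<close>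
      let ?S = "\<lambda>x. T x - (ract x b - lact b x)"
      have "clinear T" using T(1) by (simp add: derivation_along_def)
      then have "weak_star_continuous Q Q ?S"
        by (intro weak_star_continuous_diff predual clinear_diff actions_clinear T(2)
          weak_star_continuous_actions)
      then obtain b' where b': "\<And>a. mul a b' = mul b' a" "\<And>x. ?S x = ract x b' - lact b' x"
        using C4 derivation_along_inner_minus_morphism[OF T(1) b] by blast
      have "D a = mul a (b + b') - mul (b + b') a" for a
        by (simp add: b b'(1) reg.actions_add)
      moreover have "T x = ract x (b + b') - lact (b + b') x" for x
        using b'(2)[of x] by (simp add: actions_add algebra_simps)
      ultimately show "\<exists>b. (\<forall>a. D a = mul a b - mul b a) \<and> (\<forall>x. T x = ract x b - lact b x)"
        by blast
    qed
  qed
qed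

end
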